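(* Let $d\in\mathbb{N}$ with $d\ge 2$, and let $(m_k)_{k\ge 0}$ be a sequence of non-negative integers such that $m_0=0$, $m_1=1$, and $$\sum_{i=1}^{k-2}\left(\frac{k}{i}m_i+(i-1)\right)\le m_{k-1}-(k-1)\quad\text{for each } k\ge 3.$$ Moreover, let $(U_k)_{k\ge 1}$ be a family of finite subsets of the positive integers with $U_1=\emptyset$ such that, for all $k\ge 2$, $U_k$ is non-empty, $m_{k-1}+1<\min U_k\le m_{k-1}+d$, $\max U_k=m_k$, and $\max\Delta(U_k)\le d$. Then there exists a locally tame Krull monoid $H$ with finite set of distances $\Delta(H)\subseteq[\![1,d]\!]$ and with $$\mathcal{U}_k(H)\cap\mathbb{N}_{\ge k}=[\![k,m_{k-1}+1]\!]\uplus U_k\quad\text{for each } k\in\mathbb{N}$$ (where $\uplus$ denotes disjoint union). In particular, if $\min U_k+1\notin U_k$ for all $k\ge 2$, then there exists no $M\in\mathbb{N}$ such that $\mathcal{U}_k(H)$ is an AAP with difference $1$ and bound $M$ for all sufficiently large $k$, and hence $\mathcal{L}(H)$ does not satisfy the Structure Theorem for Unions.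
   Context: $\mathbb{N}$ is the set of positive integers, $\mathbb{N}_0=\mathbb{N}\cup\{0\}$, $\mathbb{N}_{\ge k}=\{n\in\mathbb{N}:n\ge k\}$; $[\![a,b]\!]=\{x\in\mathbb{Z}:a\le x\le b\}$; $\sup\emptyset=0$ (so the condition $\max\Delta(U_k)\le d$ is vacuous if $\Delta(U_k)=\emptyset$). For $L\subseteq\mathbb{N}_0$, $\Delta(L)$ is the set of all $d\in\mathbb{N}$ for which there are $k,\ell\in L$ with $\ell-k=d$ and $L\cap[\![k,\ell]\!]=\{k,\ell\}$. $L$ is an AP with difference $d\in\mathbb{N}$ if $L\ne\emptyset$ and $\Delta(L)\subseteq\{d\}$; it is an AAP with difference $d$ and bound $M\in\mathbb{N}_0$ if $L\subseteq y+d\mathbb{Z}$ for some $y\in\mathbb{Z}$ and $L\cap[\![\inf L+M,\sup L-M]\!]$ is an AP with difference $d$. A Krull monoid is a commutative cancellative semigroup $H$ with identity for which there are a free abelian monoid $F$ and a homomorphism $\varphi:H\to F$ such that $\varphi(a)\mid\varphi(b)$ in $F$ implies $a\mid b$ in $H$. $H^\times$ is the group of units, $H_{\mathrm{red}}=H/H^\times$, and $\mathcal{A}(H)$ is the set of atoms (non-units $p$ such that $p=ab$ implies $a\in H^\times$ or $b\in H^\times$). $H$ is atomic if every non-unit is a finite product of atoms (Krull monoids are atomic). For a non-unit $a$, $\mathsf{L}(a)$ is the set of $k\in\mathbb{N}$ such that $a$ is a product of $k$ atoms; $\mathsf{L}(a)=\{0\}$ for $a\in H^\times$. $\mathcal{L}(H)=\{\mathsf{L}(a):a\in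 H\}$, $\Delta(H)=\bigcup_{L\in\mathcal{L}(H)}\Delta(L)$, $\mathcal{U}_k(H)=\bigcup\{L\in\mathcal{L}(H):k\in L\}$. $\mathcal{L}(H)$ satisfies the Structure Theorem for Unions if there are $d\in\mathbb{N}$, $M\in\mathbb{N}_0$ such that $\mathcal{U}_k(H)$ is an AAP with difference $d$ and bound $M$ for all sufficiently large $k$. $\mathsf{Z}(H)$ is the free abelian monoid with basis $\mathcal{A}(H_{\mathrm{red}})$, $\pi:\mathsf{Z}(H)\to H_{\mathrm{red}}$ the canonical epimorphism, $\mathsf{Z}(a)=\pi^{-1}(aH^\times)$, $|z|$ the length of $z$. For $z,z'\in\mathsf{Z}(H)$ with $x=\gcd(z,z')$, $z=xy$, $z'=xy'$, put $\mathsf{d}(z,z')=\max\{|y|,|y'|\}$. For $u\in\mathcal{A}(H_{\mathrm{red}})$, $\mathsf{t}(H,u)$ is the smallest $N\in\mathbb{N}_0\cup\{\infty\}$ such that for every $a\in H$ with $\mathsf{Z}(a)\cap u\mathsf{Z}(H)\neq\emptyset$ and every $z\in\mathsf{Z}(a)$ there is $z'\in\mathsf{Z}(a)\cap u\mathsf{Z}(H)$ with $\mathsf{d}(z,z')\le N$. $H$ is locally tame if $\mathsf{t}(H,u)<\infty$ for all $u\in\mathcal{A}(H_{\mathrm{red}})$. *)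

theory Defs
  imports Complex_Main "HOL-Algebra.Divisibility" "HOL-Algebra.FiniteProduct" "HOL-Library.Multiset" "HOL-Library.Extended_Nat"
begin

section \<open>Sets of non-negative integers\<close>

definition distance_set :: "nat set \<Rightarrow> nat set" where
  "distance_set L = {d. d > 0 \<and> (\<exists>k\<in>L. \<exists>l\<in>L. int l - int k = int d \<and> L \<inter> {k..l} = {k, l})}"

definition is_AP :: "nat \<Rightarrow> nat set \<Rightarrow> bool" where
  "is_AP d L \<longleftrightarrow> L \<noteq> {} \<and> distance_set L \<subseteq> {d}"

text \<open>The infimum and the supremum are taken in \<^typ>\<open>enat\<close> because \<open>L\<close> may be unbounded, and the
  condition \<open>x \<le> sup L - M\<close> is written without subtraction.\<close>

definition is_AAP :: "nat \<Rightarrow> nat \<Rightarrow> nat set \<Rightarrow> bool" where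
  "is_AAP d M L \<longleftrightarrow>
     (\<exists>y::int. \<forall>x\<in>L. \<exists>z::int. int x = y + int d * z) \<and>
     is_AP d {x\<in>L. Inf (enat ` L) + enat M \<le> enat x \<and> enat x + enat M \<le> Sup (enat ` L)}"


section \<open>Krull monoids\<close>

definition free_comm_monoid :: "'p set \<Rightarrow> 'p multiset monoid" where
  "free_comm_monoid P = \<lparr>carrier = {z. set_mset z \<subseteq> P}, mult = (+), one = {#}\<rparr>"

text \<open>The basis \<open>P\<close> is taken from the element type of \<open>H\<close>, since one cannot quantify over types.
  This loses nothing, see \<open>krull_monoidI\<close> below.\<close>

definition krull_monoid :: "('a, 'b) monoid_scheme \<Rightarrow> bool" where
  "krull_monoid H \<longleftrightarrow> comm_monoid_cancel H \<and>
     (\<exists>(P :: 'a set) \<phi>. \<phi> \<in> hom H (free_comm_monoid P) \<and>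
        (\<forall>a\<in>carrier H. \<forall>b\<in>carrier H.
           \<phi> a divides\<^bsub>free_comm_monoid P\<^esub> \<phi> b \<longrightarrow> a divides\<^bsub>H\<^esub> b))"


section \<open>Factorizations and sets of lengths\<close>

definition atoms :: "('a, 'b) monoid_scheme \<Rightarrow> 'a set" where
  "atoms H = {p \<in> carrier H. irreducible H p}"

definition length_set :: "('a, 'b) monoid_scheme \<Rightarrow> 'a \<Rightarrow> nat set" where
  "length_set H a =
     (if a \<in> Units H then {0}
      else {k. k > 0 \<and> (\<exists>fs. set fs \<subseteq> carrier H \<and> factors H fs a \<and> length fs = k)})"

definition length_system :: "('a, 'b) monoid_scheme \<Rightarrow> nat set set" where
  "length_system H = length_set H ` carrier H"

definition distances :: "('a, 'b) monoid_scheme \<Rightarrow> nat set" where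
  "distances H = (\<Union>L\<in>length_system H. distance_set L)"

definition length_union :: "('a, 'b) monoid_scheme \<Rightarrow> nat \<Rightarrow> nat set" where
  "length_union H k = \<Union>{L \<in> length_system H. k \<in> L}"

definition structure_theorem_for_unions :: "('a, 'b) monoid_scheme \<Rightarrow> bool" where
  "structure_theorem_for_unions H \<longleftrightarrow>
     (\<exists>d M. d > 0 \<and> (\<forall>\<^sub>F k in sequentially. is_AAP d M (length_union H k)))"


section \<open>Local tameness\<close>

definition reduced :: "('a, 'b) monoid_scheme \<Rightarrow> 'a set monoid" where
  "reduced H = H Mod Units H"

definition factorization_monoid :: "('a, 'b) monoid_scheme \<Rightarrow> 'a set multiset monoid" where
  "factorization_monoid H = free_comm_monoid (atoms (reduced H))"

definition factorization_hom :: "('a, 'b) monoid_scheme \<Rightarrow> 'a set multiset \<Rightarrow> 'a set" where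
  "factorization_hom H z =
     finprod (reduced H) (\<lambda>u. u [^]\<^bsub>reduced H\<^esub> count z u) (set_mset z)"

text \<open>As in \<^const>\<open>FactGroup\<close>, the coset of \<open>a\<close> is written with the units on the left;
  all monoids considered are commutative.\<close>

definition factorizations :: "('a, 'b) monoid_scheme \<Rightarrow> 'a \<Rightarrow> 'a set multiset set" where
  "factorizations H a =
     {z \<in> carrier (factorization_monoid H). factorization_hom H z = Units H #>\<^bsub>H\<^esub> a}"

text \<open>\<open>z \<inter># z'\<close> is the greatest common divisor of \<open>z\<close> and \<open>z'\<close>.\<close>

definition factorization_dist :: "'p multiset \<Rightarrow> 'p multiset \<Rightarrow> nat" where
  "factorization_dist z z' =
     (let x = z \<inter># z' in max (size (z - x)) (size (z' - x)))"

text \<open>\<open>Zu\<close> is the set of factorizations of \<open>a\<close> that are divisible by \<open>u\<close>.\<close>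

definition tame_degree :: "('a, 'b) monoid_scheme \<Rightarrow> 'a set \<Rightarrow> enat" where
  "tame_degree H u = (LEAST N. \<forall>a\<in>carrier H.
     let Zu = factorizations H a \<inter> add_mset u ` carrier (factorization_monoid H)
     in Zu \<noteq> {} \<longrightarrow>
        (\<forall>z\<in>factorizations H a. \<exists>z'\<in>Zu. enat (factorization_dist z z') \<le> N))"

definition locally_tame :: "('a, 'b) monoid_scheme \<Rightarrow> bool" where
  "locally_tame H \<longleftrightarrow> (\<forall>u\<in>atoms (reduced H). tame_degree H u < \<infinity>)"


section \<open>Agreement with the textbook definitions\<close>

lemma (in comm_monoid_cancel) atoms_iff:
  "p \<in> atoms G \<longleftrightarrow> p \<in> carrier G \<and> p \<notin> Units G \<and>
     (\<forall>a\<in>carrier G. \<forall>b\<in>carrier G. p = a \<otimes> b \<longrightarrow> a \<in> Units G \<or> b \<in> Units G)"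
proof (intro iffI)
  assume p: "p \<in> atoms G"
  have "a \<in> Units G \<or> b \<in> Units G"
    if ab: "a \<in> carrier G" "b \<in> carrier G" "p = a \<otimes> b" for a b
  proof (cases "p divides a")
    case True
    then obtain c where c: "c \<in> carrier G" "a = p \<otimes> c" by (auto simp: factor_def)
    have bc: "b \<otimes> c \<in> carrier G" using ab(2) c(1) by simp
    have "a = a \<otimes> b \<otimes> c" using c(2) ab(3) by metis
    then have "a \<otimes> \<one> = a \<otimes> (b \<otimes> c)" by (metis m_assoc r_one ab(1,2) c(1))
    then have "\<one> = b \<otimes> c" using ab(1) bc one_closed l_cancel by blast
    then have "b \<in> Units G" using ab(2) c(1) unit_factor[of b c] Units_one_closed by metis
    then show ?thesis ..
  next
    case False
    have "a divides p" using ab by (auto simp: factor_def)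
    with False p ab show ?thesis
      by (auto simp: atoms_def irreducible_def properfactor_def)
  qed
  with p show "p \<in> carrier G \<and> p \<notin> Units G \<and>
     (\<forall>a\<in>carrier G. \<forall>b\<in>carrier G. p = a \<otimes> b \<longrightarrow> a \<in> Units G \<or> b \<in> Units G)"
    by (auto simp: atoms_def irreducible_def)
next
  assume R: "p \<in> carrier G \<and> p \<notin> Units G \<and>
     (\<forall>a\<in>carrier G. \<forall>b\<in>carrier G. p = a \<otimes> b \<longrightarrow> a \<in> Units G \<or> b \<in> Units G)"
  have "b \<in> Units G" if b: "b \<in> carrier G" "properfactor G b p" for b
  proof -
    from b obtain c where c: "c \<in> carrier G" "p = b \<otimes> c"
      by (auto simp: properfactor_def factor_def)
    have "c \<notin> Units G"
    proof
      assume "c \<in> Units G"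
      then have "p \<sim> b" using associatedI2 c b by blast
      with b show False by (auto simp: properfactor_def associated_def)
    qed
    with R b c show ?thesis by blast
  qed
  with R show "p \<in> atoms G" by (auto simp: atoms_def irreducible_def)
qed

lemma divides_free_comm_monoid:
  assumes "set_mset z \<subseteq> P" "set_mset w \<subseteq> P"
  shows "z divides\<^bsub>free_comm_monoid P\<^esub> w \<longleftrightarrow> z \<subseteq># w"
proof
  assume "z divides\<^bsub>free_comm_monoid P\<^esub> w"
  then show "z \<subseteq># w" by (auto simp: factor_def free_comm_monoid_def)
next
  assume "z \<subseteq># w"
  then have "w = z + (w - z)" by simp
  moreover have "set_mset (w - z) \<subseteq> P" using assms(2) by (meson in_diffD subset_iff)
  ultimately show "z divides\<^bsub>free_comm_monoid P\<^esub> w"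
    unfolding factor_def free_comm_monoid_def by simp metis
qed

lemma krull_monoidI:
  fixes H :: "('a, 'b) monoid_scheme" and P :: "'p set" and \<phi> :: "'a \<Rightarrow> 'p multiset"
  assumes H: "comm_monoid_cancel H"
    and hom: "\<phi> \<in> hom H (free_comm_monoid P)"
    and div: "\<And>a b. a \<in> carrier H \<Longrightarrow> b \<in> carrier H \<Longrightarrow>
                 \<phi> a divides\<^bsub>free_comm_monoid P\<^esub> \<phi> b \<Longrightarrow> a divides\<^bsub>H\<^esub> b"
  shows "krull_monoid H"
proof -
  interpret comm_monoid_cancel H by fact
  have add: "\<phi> (a \<otimes>\<^bsub>H\<^esub> b) = \<phi> a + \<phi> b" if "a \<in> carrier H" "b \<in> carrier H" for a b
    using hom that by (auto simp: hom_def free_comm_monoid_def)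
  have inP: "set_mset (\<phi> a) \<subseteq> P" if "a \<in> carrier H" for a
    using hom that by (auto simp: hom_def free_comm_monoid_def)
  define S where "S = (\<Union>a\<in>carrier H. set_mset (\<phi> a))"
  have "\<exists>f :: 'p \<Rightarrow> 'a. inj_on f S"
  proof (cases "finite (carrier H)")
    case True
    have "\<phi> a = {#}" if a: "a \<in> carrier H" for a
    proof -
      have pow: "\<phi> (a [^]\<^bsub>H\<^esub> n) = \<phi> \<one>\<^bsub>H\<^esub> + repeat_mset n (\<phi> a)" for n :: nat
        using a by (induction n) (auto simp: add ac_simps)
      have "range (\<lambda>n::nat. a [^]\<^bsub>H\<^esub> n) \<subseteq> carrier H" using a by auto
      then have "\<not> inj (\<lambda>n::nat. a [^]\<^bsub>H\<^esub> n)"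
        using finite_subset[OF _ True] finite_imageD infinite_UNIV_nat by blast
      then obtain i j :: nat where ij: "i \<noteq> j" "a [^]\<^bsub>H\<^esub> i = a [^]\<^bsub>H\<^esub> j"
        by (auto simp: inj_def)
      then have "repeat_mset i (\<phi> a) = repeat_mset j (\<phi> a)"
        using pow[of i] pow[of j] by simp
      then have "count (repeat_mset i (\<phi> a)) x = count (repeat_mset j (\<phi> a)) x" for x by simp
      with ij show ?thesis by (auto intro!: multiset_eqI)
    qed
    then have "S = {}" by (auto simp: S_def)
    then show ?thesis by auto
  next
    case False
    have "(card_of S, card_of (carrier H)) \<in> ordLeq"
      unfolding S_def
    proof (rule card_of_UNION_ordLeq_infinite)
      show "\<forall>a\<in>carrier H. (card_of (set_mset (\<phi> a)), card_of (carrier H)) \<in> ordLeq"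
      proof
        fix a assume "a \<in> carrier H"
        show "(card_of (set_mset (\<phi> a)), card_of (carrier H)) \<in> ordLeq"
        proof (rule disjE[OF ordLeq_total[OF card_of_Well_order card_of_Well_order]])
          assume "(card_of (carrier H), card_of (set_mset (\<phi> a))) \<in> ordLeq"
          then have "infinite (set_mset (\<phi> a))"
            using False by (rule card_of_ordLeq_infinite)
          then show ?thesis by simp
        qed
      qed
    qed (fact False, rule ordIso_imp_ordLeq[OF card_of_refl])
    then show ?thesis
      unfolding card_of_ordLeq[symmetric] by (elim exE conjE) (rule exI)
  qed
  then obtain f :: "'p \<Rightarrow> 'a" where f: "inj_on f S" ..
  let ?F = "free_comm_monoid (UNIV :: 'a set)" and ?\<psi> = "\<lambda>a. image_mset f (\<phi> a)"
  have "?\<psi> \<in> hom H ?F"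
    by (auto simp: hom_def free_comm_monoid_def add)
  moreover have "a divides\<^bsub>H\<^esub> b"
    if ab: "a \<in> carrier H" "b \<in> carrier H" and d: "?\<psi> a divides\<^bsub>?F\<^esub> ?\<psi> b" for a b
  proof (rule div[OF ab])
    have S: "set_mset (\<phi> a) \<subseteq> S" "set_mset (\<phi> b) \<subseteq> S" using ab by (auto simp: S_def)
    have inv: "image_mset (inv_into S f) (image_mset f z) = z" if "set_mset z \<subseteq> S" for z
    proof -
      have "image_mset (inv_into S f \<circ> f) z = image_mset id z"
        by (rule image_mset_cong) (use that f in auto)
      then show ?thesis by (simp add: multiset.map_comp)
    qed
    have "?\<psi> a \<subseteq># ?\<psi> b" using d by (simp add: divides_free_comm_monoid)
    then have "\<phi> a \<subseteq># \<phi> b"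
      using image_mset_subseteq_mono[of "?\<psi> a" "?\<psi> b" "inv_into S f"] inv S by simp
    then show "\<phi> a divides\<^bsub>free_comm_monoid P\<^esub> \<phi> b"
      using inP ab by (simp add: divides_free_comm_monoid)
  qed
  ultimately show ?thesis using H unfolding krull_monoid_def by blast
qed

end

theory Submission
  imports Defs "HOL-Library.FuncSet" "HOL-Library.Countable_Set"
begin

text \<open>For every \<open>k\<close> choose a finite set \<open>L k\<close> of lengths, put \<open>l\<close> generators \<open>(k, l, j)\<close>, \<open>j < l\<close>, into a
  block for each \<open>l \<in> L k\<close>, and impose only the relations that all blocks with the same \<open>k\<close> have
  the same product. The primes are the pairs \<open>(k, \<sigma>)\<close>, where \<open>\<sigma>\<close> selects one member of each block
  with index \<open>k\<close>, and the valuation of a generator at \<open>(k, \<sigma>)\<close> is \<open>1\<close> if it is selected and \<open>0\<close>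
  otherwise. If an element of the monoid divides \<open>w\<close> in the free monoid and involves a generator
  \<open>(k, l, j)\<close> that is missing in \<open>w\<close>, then \<open>w\<close> contains a full block with index \<open>k\<close>: otherwise some
  \<open>\<sigma>\<close> selects \<open>(k, l, j)\<close> and avoids \<open>w\<close>. Trading this block for the one of \<open>(k, l, j)\<close> gives the Krull
  property and local tameness, and shows that any two factorizations of an element differ
  by exchanging blocks index by index.

  The theorem is the case in which \<open>L k\<close> consists of \<open>[k, m (k - 1) + 1]\<close> and \<open>U k\<close>. If a factorization of
  length \<open>t\<close> trades a block with index \<open>t\<close>, it is that block, and the new length lies in \<open>L t\<close>; if it
  trades one with index \<open>t - 1\<close>, at most one generator is left over; if all indices \<open>i\<close> are at most
  \<open>t - 2\<close>, the growth of \<open>m\<close> gives \<open>m i / i \<le> m (t - 1) / t\<close>, so the new length is at most \<open>m (t - 1)\<close>.\<close>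

section \<open>Monoids presented by generators\<close>

text \<open>This is the recursion for \<open>factorization_hom\<close>, whose product runs over the
  support of a multiset. The factor at \<open>u\<close> has to be split off first, because
  \<open>u\<close> may or may not occur in \<open>z\<close> already.\<close>

lemma (in comm_monoid) finprod_pow_add_mset:
  assumes "set_mset z \<subseteq> carrier G" "u \<in> carrier G"
  shows "(\<Otimes>x\<in>set_mset (add_mset u z). x [^] count (add_mset u z) x)
       = u \<otimes> (\<Otimes>x\<in>set_mset z. x [^] count z x)"
proof -
  define A where "A = set_mset z - {u}"
  have A: "finite A" "u \<notin> A" "A \<subseteq> carrier G" using assms by (auto simp: A_def)
  have eq: "(\<Otimes>x\<in>A. x [^] count (add_mset u z) x) = (\<Otimes>x\<in>A. x [^] count z x)"
    using A by (intro finprod_cong') auto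
  have clo: "(\<Otimes>x\<in>A. x [^] count z x) \<in> carrier G"
    using A by (intro finprod_closed) auto
  have "(\<Otimes>x\<in>insert u A. x [^] count (add_mset u z) x)
      = u [^] Suc (count z u) \<otimes> (\<Otimes>x\<in>A. x [^] count z x)"
    using A assms eq by (subst finprod_insert) auto
  also have "\<dots> = u \<otimes> (u [^] count z u \<otimes> (\<Otimes>x\<in>A. x [^] count z x))"
    using assms clo by (simp add: m_ac nat_pow_Suc2)
  also have "u [^] count z u \<otimes> (\<Otimes>x\<in>A. x [^] count z x)
      = (\<Otimes>x\<in>set_mset z. x [^] count z x)"
  proof (cases "u \<in># z")
    case True
    then have z: "set_mset z = insert u A" by (auto simp: A_def)
    show ?thesis unfolding z using A assms by (subst finprod_insert) auto
  next
    case False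
    then have "count z u = 0" "set_mset z = A" by (auto simp: A_def not_in_iff)
    then show ?thesis using clo by simp
  qed
  finally show ?thesis by (simp add: A_def)
qed

text \<open>The relations among the generators are the pairs of multisets with equal image under
  \<open>\<phi>\<close>. By the last assumption no relation involves a single generator, so the
  generators give distinct atoms, and the factorizations of \<open>\<phi> z\<close> correspond to
  the multisets \<open>w\<close> over \<open>W\<close> with
  \<open>\<phi> w = \<phi> z\<close>.\<close>

locale presentation = comm_monoid_cancel H
  for H :: "('a, 'b) monoid_scheme" (structure)
  and W :: "'u set" and \<phi> :: "'u multiset \<Rightarrow> 'a" +
  assumes Units_trivial: "Units H = {\<one>}"
    and carrier_eq: "carrier H = \<phi> ` {z. set_mset z \<subseteq> W}"
    and \<phi>_empty: "\<phi> {#} = \<one>"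
    and \<phi>_add: "set_mset z \<subseteq> W \<Longrightarrow> set_mset w \<subseteq> W \<Longrightarrow> \<phi> (z + w) = \<phi> z \<otimes> \<phi> w"
    and \<phi>_generator: "u \<in> W \<Longrightarrow> set_mset w \<subseteq> W \<Longrightarrow> \<phi> w = \<phi> {#u#} \<Longrightarrow> w = {#u#}"
begin

section \<open>Atoms and sets of lengths of a presented monoid\<close>

lemma \<phi>_closed: "set_mset z \<subseteq> W \<Longrightarrow> \<phi> z \<in> carrier H"
  by (auto simp: carrier_eq)

lemma \<phi>_generator_neq_one: "u \<in> W \<Longrightarrow> \<phi> {#u#} \<noteq> \<one>"
  using \<phi>_generator[of u "{#}"] \<phi>_empty by auto

text \<open>Splitting one generator off an atom leaves a unit, hence \<open>\<one>\<close>.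
  Conversely, a product of two elements that equals a generator lifts to a sum of two multisets of
  total size one, so one of them is empty.\<close>

lemma atoms_eq: "atoms H = (\<lambda>u. \<phi> {#u#}) ` W"
proof (intro equalityI subsetI)
  fix p assume p: "p \<in> atoms H"
  then obtain z where z: "set_mset z \<subseteq> W" "p = \<phi> z"
    by (auto simp: atoms_def carrier_eq)
  have "z \<noteq> {#}" using p z \<phi>_empty Units_trivial by (auto simp: atoms_iff)
  then obtain u y where y: "z = add_mset u y" by (cases z) auto
  then have uy: "u \<in> W" "set_mset y \<subseteq> W" using z by auto
  then have "p = \<phi> {#u#} \<otimes> \<phi> y" using \<phi>_add[of "{#u#}" y] z y by simp
  moreover have "\<phi> {#u#} \<notin> Units H" using \<phi>_generator_neq_one uy Units_trivial by simp
  ultimately have "\<phi> y \<in> Units H"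
    using p uy \<phi>_closed[of y] \<phi>_closed[of "{#u#}"] unfolding atoms_iff by auto
  then have "p = \<phi> {#u#}"
    using \<open>p = \<phi> {#u#} \<otimes> \<phi> y\<close> uy \<phi>_closed[of "{#u#}"] Units_trivial by simp
  then show "p \<in> (\<lambda>u. \<phi> {#u#}) ` W" using uy by blast
next
  fix p assume "p \<in> (\<lambda>u. \<phi> {#u#}) ` W"
  then obtain u where u: "u \<in> W" "p = \<phi> {#u#}" by blast
  have "a = \<one> \<or> b = \<one>"
    if ab: "a \<in> carrier H" "b \<in> carrier H" "p = a \<otimes> b" for a b
  proof -
    obtain z w where zw: "set_mset z \<subseteq> W" "set_mset w \<subseteq> W" "a = \<phi> z" "b = \<phi> w"
      using ab by (auto simp: carrier_eq)
    then have "\<phi> (z + w) = \<phi> {#u#}" using \<phi>_add ab u by simp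
    then have "z + w = {#u#}" using \<phi>_generator[OF u(1), of "z + w"] zw by simp
    then have "z = {#} \<or> w = {#}" by (auto simp: union_is_single)
    then show ?thesis using zw \<phi>_empty by auto
  qed
  then show "p \<in> atoms H"
    using u \<phi>_generator_neq_one \<phi>_closed[of "{#u#}"] by (auto simp: atoms_iff Units_trivial)
qed

lemma foldr_generators:
  "set us \<subseteq> W \<Longrightarrow> foldr (\<otimes>) (map (\<lambda>u. \<phi> {#u#}) us) \<one> = \<phi> (mset us)"
proof (induction us)
  case (Cons u us)
  then show ?case using \<phi>_add[of "{#u#}" "mset us"] by simp
qed (simp add: \<phi>_empty)

lemma \<phi>_eq_one_iff:
  assumes "set_mset z \<subseteq> W"
  shows "\<phi> z = \<one> \<longleftrightarrow> z = {#}"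
proof
  assume z: "\<phi> z = \<one>"
  show "z = {#}"
  proof (rule ccontr)
    assume "z \<noteq> {#}"
    then obtain u y where y: "z = add_mset u y" by (cases z) auto
    then have uy: "u \<in> W" "set_mset y \<subseteq> W" using assms by auto
    then have "\<phi> {#u#} \<otimes> \<phi> y = \<one>" using \<phi>_add[of "{#u#}" y] z y by simp
    then have "\<phi> {#u#} \<in> Units H"
      using unit_factor[of "\<phi> {#u#}" "\<phi> y"] \<phi>_closed[of y] \<phi>_closed[of "{#u#}"] uy by auto
    then show False using Units_trivial \<phi>_generator_neq_one uy by simp
  qed
qed (simp add: \<phi>_empty)

text \<open>Lists of atoms lift to lists of generators by \<open>atoms_eq\<close>. The case
  \<open>\<phi> z = \<one>\<close> is separate because \<open>length_set\<close> has the value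
  \<open>{0}\<close> there by convention; it matches the empty multiset.\<close>

lemma length_set_eq:
  assumes z: "set_mset z \<subseteq> W"
  shows "length_set H (\<phi> z) = size ` {w. set_mset w \<subseteq> W \<and> \<phi> w = \<phi> z}"
proof (cases "\<phi> z = \<one>")
  case True
  then have "{w. set_mset w \<subseteq> W \<and> \<phi> w = \<phi> z} = {{#}}"
    using \<phi>_eq_one_iff \<phi>_empty by auto
  then show ?thesis using True by (simp add: length_set_def Units_trivial)
next
  case False
  have "(\<exists>fs. set fs \<subseteq> carrier H \<and> factors H fs (\<phi> z) \<and> length fs = k)
     \<longleftrightarrow> (\<exists>w. set_mset w \<subseteq> W \<and> \<phi> w = \<phi> z \<and> size w = k)" (is "?l \<longleftrightarrow> ?r") for k
  proof
    assume ?l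
    then obtain fs where fs: "set fs \<subseteq> carrier H" "factors H fs (\<phi> z)" "length fs = k" by blast
    then have "set fs \<subseteq> (\<lambda>u. \<phi> {#u#}) ` W"
      unfolding atoms_eq[symmetric] by (auto simp: factors_def atoms_def)
    then have "fs \<in> map (\<lambda>u. \<phi> {#u#}) ` lists W"
      unfolding lists_image[symmetric] by (simp add: in_lists_conv_set subset_iff)
    then obtain us where us: "set us \<subseteq> W" "fs = map (\<lambda>u. \<phi> {#u#}) us"
      by (auto simp: in_lists_conv_set)
    then have "\<phi> (mset us) = \<phi> z" using fs foldr_generators by (simp add: factors_def)
    then show ?r using us fs by (intro exI[of _ "mset us"]) simp
  next
    assume ?r
    then obtain w where w: "set_mset w \<subseteq> W" "\<phi> w = \<phi> z" "size w = k" by blast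
    obtain us where us: "mset us = w" using ex_mset by blast
    let ?fs = "map (\<lambda>u. \<phi> {#u#}) us"
    have set_us: "set us \<subseteq> W" using w us by (metis set_mset_mset)
    then have "set ?fs \<subseteq> atoms H" unfolding atoms_eq by auto
    then have "factors H ?fs (\<phi> z)" "set ?fs \<subseteq> carrier H"
      using foldr_generators[OF set_us] us w by (auto simp: factors_def atoms_def)
    moreover have "length ?fs = k" using us w by (metis length_map size_mset)
    ultimately show ?l by blast
  qed
  then have "length_set H (\<phi> z) = {k. k > 0 \<and> (\<exists>w. set_mset w \<subseteq> W \<and> \<phi> w = \<phi> z \<and> size w = k)}"
    using False by (simp add: length_set_def Units_trivial)
  moreover have "size w > 0" if "set_mset w \<subseteq> W" "\<phi> w = \<phi> z" for w
    using that False \<phi>_empty by (cases w) auto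
  ultimately show ?thesis by auto
qed

section \<open>The reduced monoid, its factorizations and local tameness\<close>

lemma reduced_simps:
  "carrier (reduced H) = (\<lambda>a. {a}) ` carrier H"
  "\<one>\<^bsub>reduced H\<^esub> = {\<one>}"
  "{a} \<otimes>\<^bsub>reduced H\<^esub> {b} = {a \<otimes> b}"
  \<comment> \<open>As \<open>\<one>\<close> is the only unit, every coset of the group of units is
    a singleton.\<close>
  by (auto simp: reduced_def FactGroup_def RCOSETS_def r_coset_def Units_trivial set_mult_def)

lemma comm_monoid_cancel_reduced: "comm_monoid_cancel (reduced H)"
proof (rule comm_monoid_cancelI)
  show "comm_monoid (reduced H)"
    by (rule comm_monoidI) (auto simp: reduced_simps m_ac)
qed (use r_cancel in \<open>auto simp: reduced_simps\<close>)

lemma Units_reduced: "Units (reduced H) = {{\<one>}}"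
proof (intro equalityI subsetI)
  fix a assume "a \<in> Units (reduced H)"
  then obtain b where ab: "a \<in> carrier (reduced H)" "b \<in> carrier (reduced H)"
    "a \<otimes>\<^bsub>reduced H\<^esub> b = \<one>\<^bsub>reduced H\<^esub>"
    unfolding Units_def by blast
  obtain x where x: "x \<in> carrier H" "a = {x}" using ab(1) unfolding reduced_simps by blast
  obtain y where y: "y \<in> carrier H" "b = {y}" using ab(2) unfolding reduced_simps by blast
  have "x \<otimes> y \<in> Units H" using ab(3) x y by (simp add: reduced_simps)
  then have "x \<in> Units H" by (rule unit_factor) (use x y in simp_all)
  then show "a \<in> {{\<one>}}" using x by (simp add: Units_trivial)
next
  interpret R: comm_monoid_cancel "reduced H" by (rule comm_monoid_cancel_reduced)
  fix a assume "a \<in> {{\<one>}}"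
  then show "a \<in> Units (reduced H)" using R.Units_one_closed by (simp add: reduced_simps)
qed

lemma atoms_reduced: "atoms (reduced H) = (\<lambda>u. {\<phi> {#u#}}) ` W"
proof -
  interpret R: comm_monoid_cancel "reduced H" by (rule comm_monoid_cancel_reduced)
  have iff: "{a} \<in> atoms (reduced H) \<longleftrightarrow> a \<in> atoms H" for a
    by (simp add: R.atoms_iff atoms_iff Units_trivial Units_reduced reduced_simps image_iff)
  have "atoms (reduced H) = (\<lambda>a. {a}) ` atoms H"
  proof (intro equalityI subsetI)
    fix x assume x: "x \<in> atoms (reduced H)"
    then have "x \<in> (\<lambda>a. {a}) ` carrier H" by (simp add: R.atoms_iff reduced_simps)
    then show "x \<in> (\<lambda>a. {a}) ` atoms H" using x iff by blast
  qed (use iff in blast)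
  then show ?thesis by (simp add: atoms_eq image_image)
qed

lemma factorization_hom_image:
  "set_mset w \<subseteq> W \<Longrightarrow> factorization_hom H (image_mset (\<lambda>u. {\<phi> {#u#}}) w) = {\<phi> w}"
proof (induction w)
  case empty
  interpret R: comm_monoid_cancel "reduced H" by (rule comm_monoid_cancel_reduced)
  have "factorization_hom H {#} = \<one>\<^bsub>reduced H\<^esub>" by (simp add: factorization_hom_def)
  then show ?case by (simp add: reduced_simps \<phi>_empty)
next
  case (add u w)
  interpret R: comm_monoid_cancel "reduced H" by (rule comm_monoid_cancel_reduced)
  let ?z = "image_mset (\<lambda>u. {\<phi> {#u#}}) w"
  have W: "u \<in> W" "set_mset w \<subseteq> W" using add.prems by auto
  have gen: "{\<phi> {#v#}} \<in> carrier (reduced H)" if "v \<in> W" for v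
    using that \<phi>_closed[of "{#v#}"] by (simp add: reduced_simps)
  have "factorization_hom H (add_mset {\<phi> {#u#}} ?z) = {\<phi> {#u#}} \<otimes>\<^bsub>reduced H\<^esub> factorization_hom H ?z"
    unfolding factorization_hom_def using W gen by (intro R.finprod_pow_add_mset) auto
  then show ?case using add.IH W \<phi>_add[of "{#u#}" w] by (simp add: reduced_simps)
qed

lemma factorizations_eq:
  assumes "set_mset z \<subseteq> W"
  shows "factorizations H (\<phi> z)
       = image_mset (\<lambda>u. {\<phi> {#u#}}) ` {w. set_mset w \<subseteq> W \<and> \<phi> w = \<phi> z}" (is "_ = ?f ` ?A")
proof -
  have car: "carrier (factorization_monoid H) = ?f ` {w. set_mset w \<subseteq> W}"
  proof (intro equalityI subsetI)
    fix y assume "y \<in> carrier (factorization_monoid H)"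
    then have "set_mset y \<subseteq> (\<lambda>u. {\<phi> {#u#}}) ` W"
      by (simp add: factorization_monoid_def free_comm_monoid_def atoms_reduced)
    then have "\<exists>w. set_mset w \<subseteq> W \<and> y = ?f w"
    proof (induction y)
      case (add x y)
      then obtain w u where "set_mset w \<subseteq> W" "y = ?f w" "u \<in> W" "x = {\<phi> {#u#}}" by auto
      then show ?case by (intro exI[of _ "add_mset u w"]) auto
    qed simp
    then show "y \<in> ?f ` {w. set_mset w \<subseteq> W}" by blast
  next
    fix y assume "y \<in> ?f ` {w. set_mset w \<subseteq> W}"
    then obtain w where "set_mset w \<subseteq> W" "y = ?f w" by blast
    then show "y \<in> carrier (factorization_monoid H)"
      by (simp add: factorization_monoid_def free_comm_monoid_def atoms_reduced image_mono)
  qed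
  have "Units H #> \<phi> z = {\<phi> z}"
    using \<phi>_closed[OF assms] by (simp add: Units_trivial r_coset_def)
  then show ?thesis unfolding factorizations_def car using factorization_hom_image by auto
qed

text \<open>Local tameness may be tested on multisets of generators instead of multisets of cosets;
  the bound \<open>N\<close> may depend on \<open>u\<close>.\<close>

lemma locally_tameI:
  assumes tame: "\<And>u. u \<in> W \<Longrightarrow> \<exists>N. \<forall>z w. set_mset z \<subseteq> W \<and> set_mset w \<subseteq> W \<and> u \<in># z \<and> \<phi> z = \<phi> w
      \<longrightarrow> (\<exists>w'. set_mset w' \<subseteq> W \<and> u \<in># w' \<and> \<phi> w' = \<phi> w \<and> factorization_dist w w' \<le> N)"
  shows "locally_tame H"
  unfolding locally_tame_def atoms_reduced
proof safe
  fix u assume u: "u \<in> W"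
  let ?g = "\<lambda>u. {\<phi> {#u#}}"
  let ?f = "image_mset ?g"
  \<comment> \<open>Injectivity serves to recover \<open>u\<close> in \<open>z\<close> from its
    coset in the image of \<open>z\<close>.\<close>
  have inj: "inj_on ?g W"
  proof (rule inj_onI)
    fix x y assume "x \<in> W" "y \<in> W" "{\<phi> {#x#}} = {\<phi> {#y#}}"
    then show "x = y" using \<phi>_generator[of y "{#x#}"] by simp
  qed
  obtain N where N: "\<And>z w. set_mset z \<subseteq> W \<Longrightarrow> set_mset w \<subseteq> W \<Longrightarrow> u \<in># z \<Longrightarrow> \<phi> z = \<phi> w
      \<Longrightarrow> \<exists>w'. set_mset w' \<subseteq> W \<and> u \<in># w' \<and> \<phi> w' = \<phi> w \<and> factorization_dist w w' \<le> N"
    using tame[OF u] by blast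
  \<comment> \<open>The common part \<open>r\<close> is mapped into the common part of the images.
    If the latter exceeds the image of \<open>r\<close> by \<open>s\<close>, both remainders shrink
    by \<open>s\<close>, so the distance cannot grow.\<close>
  have dist: "factorization_dist (?f w) (?f w') \<le> factorization_dist w w'" for w w'
  proof -
    define r where "r = w \<inter># w'"
    define y where "y = w - r"
    define y' where "y' = w' - r"
    have r: "r = w \<inter># w'" "w = r + y" "w' = r + y'"
      unfolding y_def y'_def by (auto simp: r_def multiset_eq_iff)
    have "?f r \<subseteq># ?f w \<inter># ?f w'" using r by simp
    then obtain s where s: "?f w \<inter># ?f w' = ?f r + s" by (metis subset_mset.le_iff_add)
    have le: "size (A - B) \<le> size A" for A B :: "'a set multiset"
      by (intro size_mset_mono diff_subset_eq_self)
    have "?f w - ?f w \<inter># ?f w' = ?f y - s"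
      unfolding s by (subst r(2), subst image_mset_union) (simp only: add_diff_cancel_left)
    then have "size (?f w - ?f w \<inter># ?f w') \<le> size y"
      using le[of "?f y" s] by (simp only: size_image_mset)
    moreover have "?f w' - ?f w \<inter># ?f w' = ?f y' - s"
      unfolding s by (subst r(3), subst image_mset_union) (simp only: add_diff_cancel_left)
    then have "size (?f w' - ?f w \<inter># ?f w') \<le> size y'"
      using le[of "?f y'" s] by (simp only: size_image_mset)
    moreover have "w - w \<inter># w' = y" "w' - w \<inter># w' = y'"
      by (simp_all only: y_def y'_def r(1))
    ultimately show ?thesis unfolding factorization_dist_def Let_def by (simp only: max.mono)
  qed
  have "tame_degree H {\<phi> {#u#}} \<le> enat N"
    unfolding tame_degree_def
  proof (rule Least_le, safe)
    fix a assume "a \<in> carrier H"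
    then obtain z0 where z0: "set_mset z0 \<subseteq> W" "a = \<phi> z0" by (auto simp: carrier_eq)
    let ?Zu = "factorizations H a \<inter> add_mset {\<phi> {#u#}} ` carrier (factorization_monoid H)"
    show "let Zu = ?Zu in Zu \<noteq> {} \<longrightarrow>
        (\<forall>z\<in>factorizations H a. \<exists>z'\<in>Zu. enat (factorization_dist z z') \<le> enat N)"
      unfolding Let_def
    proof (intro impI ballI)
      fix y assume "?Zu \<noteq> {}" and y: "y \<in> factorizations H a"
      then obtain x where "x \<in> ?Zu" by blast
      then have "x \<in> factorizations H a" "{\<phi> {#u#}} \<in># x" by auto
      then obtain z where z: "set_mset z \<subseteq> W" "\<phi> z = a" "{\<phi> {#u#}} \<in># ?f z"
        unfolding z0(2) factorizations_eq[OF z0(1)] by auto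
      then have "u \<in># z" using inj u by (auto dest: inj_onD)
      moreover obtain w where w: "set_mset w \<subseteq> W" "\<phi> w = a" "y = ?f w"
        using y unfolding z0(2) factorizations_eq[OF z0(1)] by auto
      ultimately obtain w' where w': "set_mset w' \<subseteq> W" "u \<in># w'" "\<phi> w' = a"
        "factorization_dist w w' \<le> N"
        using N[of z w] z by auto
      have "?f w' \<in> factorizations H a"
        unfolding z0(2) factorizations_eq[OF z0(1)] using w' z0 by auto
      moreover have "?f w' = add_mset {\<phi> {#u#}} (?f (w' - {#u#}))"
        using w'(2) by (subst insert_DiffM[symmetric, OF w'(2)]) (rule image_mset_add_mset)
      moreover have "?f (w' - {#u#}) \<in> carrier (factorization_monoid H)"
        using w' by (auto simp: factorization_monoid_def free_comm_monoid_def atoms_reduced dest: in_diffD)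
      ultimately have "?f w' \<in> ?Zu" by blast
      moreover have "factorization_dist y (?f w') \<le> N" using dist[of w w'] w'(4) w(3) by simp
      ultimately show "\<exists>z'\<in>?Zu. enat (factorization_dist y z') \<le> enat N" by auto
    qed
  qed
  then show "tame_degree H {\<phi> {#u#}} < \<infinity>"
    by (rule order_le_less_trans) simp
qed

end

section \<open>Exchanging blocks\<close>

lemma mset_set_subseteq_iff:
  assumes "finite A"
  shows "mset_set A \<subseteq># w \<longleftrightarrow> A \<subseteq> set_mset w"
  using assms by (auto simp: subseteq_mset_def count_mset_set' Suc_le_eq)

text \<open>A block with a single member would identify this generator with the product of each
  longer block of the same index, and the generator would not be an atom.\<close>

locale block_monoid =
  fixes L :: "nat \<Rightarrow> nat set"
  assumes finite_L: "finite (L k)"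
    and L_ge_2: "l \<in> L k \<Longrightarrow> 2 \<le> l"
begin

section \<open>Generators, primes and valuations\<close>

definition generators :: "(nat \<times> nat \<times> nat) set" where
  "generators = {(k, l, j). l \<in> L k \<and> j < l}"

text \<open>The functions are extensional, so that there are only finitely many choices for each
  \<open>k\<close> and the valuation of a generator is a finite multiset.\<close>

definition choices :: "nat \<Rightarrow> (nat \<Rightarrow> nat) set" where
  "choices k = (\<Pi>\<^sub>E l\<in>L k. {..<l})"

text \<open>The countably many pairs are coded by natural numbers, so that the monoid has the type
  \<open>nat multiset monoid\<close> independently of \<open>L\<close>.\<close>

definition prime_code :: "nat \<times> (nat \<Rightarrow> nat) \<Rightarrow> nat" where
  "prime_code = to_nat_on (SIGMA k:UNIV. choices k)"

definition primes_above :: "nat \<times> nat \<times> nat \<Rightarrow> nat set" where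
  "primes_above u = (case u of (k, l, j) \<Rightarrow> prime_code ` ({k} \<times> {\<sigma> \<in> choices k. \<sigma> l = j}))"

definition val :: "(nat \<times> nat \<times> nat) multiset \<Rightarrow> nat multiset" where
  "val z = (\<Sum>u\<in>#z. mset_set (primes_above u))"

definition block :: "nat \<times> nat \<Rightarrow> (nat \<times> nat \<times> nat) multiset" where
  "block b = mset_set ((\<lambda>j. (fst b, snd b, j)) ` {..<snd b})"

definition monoid_of_blocks :: "nat multiset monoid" where
  "monoid_of_blocks =
     \<lparr>carrier = val ` {z. set_mset z \<subseteq> generators}, mult = (+), one = {#}\<rparr>"

lemma monoid_of_blocks_simps:
  "carrier monoid_of_blocks = val ` {z. set_mset z \<subseteq> generators}"
  "x \<otimes>\<^bsub>monoid_of_blocks\<^esub> y = x + y"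
  "\<one>\<^bsub>monoid_of_blocks\<^esub> = {#}"
  by (simp_all add: monoid_of_blocks_def)

lemma finite_choices: "finite (choices k)"
  unfolding choices_def by (intro finite_PiE finite_L) simp

lemma prime_code_eq_iff:
  assumes "\<sigma> \<in> choices k" "\<tau> \<in> choices k'"
  shows "prime_code (k, \<sigma>) = prime_code (k', \<tau>) \<longleftrightarrow> k = k' \<and> \<sigma> = \<tau>"
proof -
  have "countable (SIGMA k:UNIV. choices k)"
    by (rule countable_SIGMA) (simp_all add: countable_finite finite_choices)
  then have "inj_on prime_code (SIGMA k:UNIV. choices k)"
    unfolding prime_code_def by (rule inj_on_to_nat_on)
  then show ?thesis using assms by (auto dest: inj_onD)
qed

lemma finite_primes_above: "finite (primes_above u)"
  by (auto simp: primes_above_def finite_choices split: prod.split)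

lemma prime_code_in_primes_above:
  "\<sigma> \<in> choices k \<Longrightarrow> prime_code (k, \<sigma>) \<in> primes_above (k', l, j) \<longleftrightarrow> k = k' \<and> \<sigma> l = j"
  by (auto simp: primes_above_def prime_code_eq_iff)

lemma val_empty [simp]: "val {#} = {#}"
  and val_add_mset [simp]: "val (add_mset u z) = mset_set (primes_above u) + val z"
  and val_union [simp]: "val (z + w) = val z + val w"
  by (simp_all add: val_def)

lemma in_val_iff: "p \<in># val z \<longleftrightarrow> (\<exists>u\<in>#z. p \<in> primes_above u)"
  by (induction z) (auto simp: finite_primes_above)

lemma primes_above_generator:
  assumes "u \<in> generators"
  shows "primes_above u \<noteq> {}"
proof -
  obtain k l j where u: "u = (k, l, j)" "l \<in> L k" "j < l"
    using assms by (auto simp: generators_def)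
  \<comment> \<open>The value \<open>0\<close> is admissible in the other blocks because no block is
    empty; \<open>undefined\<close> outside \<open>L k\<close> makes the function
    extensional.\<close>
  let ?\<sigma> = "\<lambda>i. if i \<in> L k then if i = l then j else 0 else undefined"
  have "?\<sigma> \<in> choices k" using u L_ge_2[of _ k] by (force simp: choices_def PiE_iff extensional_def)
  then show ?thesis using u by (auto simp: primes_above_def)
qed

lemma val_eq_empty_iff: "set_mset z \<subseteq> generators \<Longrightarrow> val z = {#} \<longleftrightarrow> z = {#}"
  by (cases z) (auto dest!: primes_above_generator simp: finite_primes_above mset_set_empty_iff)

text \<open>Every choice selects exactly one member of the block, so each prime with index
  \<open>k\<close> occurs exactly once in the product. The right-hand side does not mention
  \<open>l\<close>, which gives the defining relations.\<close>

lemma val_block: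
  assumes "l \<in> L k"
  shows "val (block (k, l)) = mset_set (prime_code ` ({k} \<times> choices k))"
proof -
  have *: "val (block (k, l)) = (\<Sum>j<l. mset_set (primes_above (k, l, j)))"
    unfolding val_def block_def sum_unfold_sum_mset[symmetric]
    by (subst sum.reindex) (auto simp: inj_on_def)
  show ?thesis
  proof (rule multiset_eqI)
    fix p
    have "count (val (block (k, l))) p = (\<Sum>j<l. if p \<in> primes_above (k, l, j) then 1 else 0)"
      by (simp add: * count_sum count_mset_set' finite_primes_above)
    also have "\<dots> = (if p \<in> prime_code ` ({k} \<times> choices k) then 1 else 0)"
    proof (cases "p \<in> prime_code ` ({k} \<times> choices k)")
      case True
      then obtain \<sigma> where \<sigma>: "\<sigma> \<in> choices k" "p = prime_code (k, \<sigma>)" by auto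
      then have "\<sigma> l < l" using assms by (auto simp: choices_def PiE_iff)
      then show ?thesis using \<sigma> by (simp add: prime_code_in_primes_above)
    qed (auto simp: primes_above_def)
    also have "\<dots> = count (mset_set (prime_code ` ({k} \<times> choices k))) p"
      by (simp add: count_mset_set' finite_choices)
    finally show "count (val (block (k, l))) p = \<dots>" .
  qed
qed

section \<open>Divisibility and the exchange of blocks\<close>

lemma val_block_eq: "l \<in> L k \<Longrightarrow> l' \<in> L k \<Longrightarrow> val (block (k, l)) = val (block (k, l'))"
  by (simp add: val_block)

lemma block_subseteq_iff: "block (k, l) \<subseteq># w \<longleftrightarrow> (\<forall>j<l. (k, l, j) \<in># w)"
  unfolding block_def by (subst mset_set_subseteq_iff) auto

lemma in_block_iff: "u \<in># block (k, l) \<longleftrightarrow> (\<exists>j<l. u = (k, l, j))"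
  unfolding block_def by auto

lemma size_block: "size (block (k, l)) = l"
  unfolding block_def by (simp add: card_image inj_on_def)

lemma set_block_subseteq: "l \<in> L k \<Longrightarrow> set_mset (block (k, l)) \<subseteq> generators"
  by (auto simp: in_block_iff generators_def)

lemma block_subseteq_if_val_subseteq:
  assumes "(k, l, j) \<in># z" "(k, l, j) \<in> generators" "(k, l, j) \<notin># w"
    and w: "set_mset w \<subseteq> generators" and val: "val z \<subseteq># val w"
  shows "\<exists>l'\<in>L k. block (k, l') \<subseteq># w"
proof (rule ccontr)
  assume "\<not> ?thesis"
  then have "\<forall>l'\<in>L k. \<exists>i<l'. (k, l', i) \<notin># w" by (auto simp: block_subseteq_iff)
  then obtain f where f: "\<And>l'. l' \<in> L k \<Longrightarrow> f l' < l' \<and> (k, l', f l') \<notin># w" by metis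
  \<comment> \<open>\<open>f\<close> picks from each block a member missing in \<open>w\<close>.
    Changing its value at \<open>l\<close> to \<open>j\<close> preserves this, since
    \<open>(k, l, j)\<close> is missing too, and makes the prime of \<open>\<sigma>\<close> divide
    \<open>val z\<close>.\<close>
  define \<sigma> where "\<sigma> = restrict (f(l := j)) (L k)"
  have l: "l \<in> L k" "j < l" using assms(2) by (auto simp: generators_def)
  have \<sigma>: "\<sigma> \<in> choices k" using f l by (auto simp: \<sigma>_def choices_def)
  have "prime_code (k, \<sigma>) \<in># val z"
    unfolding in_val_iff
    by (rule bexI[OF _ assms(1)]) (use l in \<open>simp only: prime_code_in_primes_above[OF \<sigma>], simp add: \<sigma>_def\<close>)
  then have "prime_code (k, \<sigma>) \<in># val w" using val by (meson mset_subset_eqD)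
  then obtain k' l' i where "(k', l', i) \<in># w" "prime_code (k, \<sigma>) \<in> primes_above (k', l', i)"
    by (auto simp: in_val_iff)
  then have l': "(k, l', \<sigma> l') \<in># w" by (simp add: prime_code_in_primes_above[OF \<sigma>])
  moreover from this have "l' \<in> L k" using w by (auto simp: generators_def)
  ultimately show False using f assms(3) by (auto simp: \<sigma>_def split: if_splits)
qed

lemma val_swap_block:
  assumes "block (k, l') \<subseteq># w" "l \<in> L k" "l' \<in> L k"
  shows "val (w - block (k, l') + block (k, l)) = val w"
proof -
  have "val w = val (w - block (k, l')) + val (block (k, l'))"
    using assms(1) by (metis val_union subset_mset.diff_add)
  then show ?thesis using val_block_eq[OF assms(2,3)] by simp
qed

lemma set_swap_block:
  assumes "set_mset w \<subseteq> generators" "l \<in> L k"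
  shows "set_mset (w - block (k, l') + block (k, l)) \<subseteq> generators"
  using assms set_block_subseteq[OF assms(2)] by (auto dest: in_diffD)

text \<open>The generators of \<open>z\<close> are cancelled one by one. When the next one is
  missing in \<open>w\<close>, exchanging one block of \<open>w\<close> produces another multiset
  with the same valuation that contains it.\<close>

lemma val_subseteq_imp_factor:
  assumes "set_mset z \<subseteq> generators" "set_mset w \<subseteq> generators" "val z \<subseteq># val w"
  shows "\<exists>y. set_mset y \<subseteq> generators \<and> val w = val z + val y"
  using assms
proof (induction z arbitrary: w)
  case empty
  then show ?case by auto
next
  case (add u z)
  obtain k l j where u: "u = (k, l, j)" "l \<in> L k" "j < l" "u \<in> generators"
    using add.prems(1) by (auto simp: generators_def)
  obtain w' where w': "val w' = val w" "set_mset w' \<subseteq> generators" "u \<in># w'"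
  proof (cases "u \<in># w")
    case True
    then show ?thesis using that[of w] add.prems by simp
  next
    case False
    then obtain l' where l': "l' \<in> L k" "block (k, l') \<subseteq># w"
      using block_subseteq_if_val_subseteq[of k l j "add_mset u z" w] add.prems u by auto
    show ?thesis
    proof (rule that)
      show "val (w - block (k, l') + block (k, l)) = val w"
        using l' u by (intro val_swap_block)
      show "u \<in># w - block (k, l') + block (k, l)" using u by (auto simp: in_block_iff)
    qed (intro set_swap_block add.prems u)
  qed
  then obtain v where v: "w' = add_mset u v" by (metis insert_DiffM)
  then have "val z \<subseteq># val v" "set_mset z \<subseteq> generators" "set_mset v \<subseteq> generators"
    using add.prems w' by (auto simp: w'(1)[symmetric])
  then obtain y where "set_mset y \<subseteq> generators" "val v = val z + val y" using add.IH by blast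
  then have "val w = val (add_mset u z) + val y"
    using v by (simp add: w'(1)[symmetric] add.assoc)
  then show ?case using \<open>set_mset y \<subseteq> generators\<close> by blast
qed

text \<open>If the two factorizations are disjoint and \<open>(k, l, j)\<close> occurs in \<open>z\<close>, then \<open>w\<close> contains some
  block with index \<open>k\<close>; as no member of that block occurs in \<open>z\<close>, also \<open>z\<close> contains such a block.\<close>

lemma exchange:
  assumes "set_mset z \<subseteq> generators" "set_mset w \<subseteq> generators" "val z = val w"
  shows "\<exists>r P Q. z = r + (\<Sum>b\<in>#P. block b) \<and> w = r + (\<Sum>b\<in>#Q. block b) \<and>
           set_mset P \<subseteq> Sigma UNIV L \<and> set_mset Q \<subseteq> Sigma UNIV L \<and>
           image_mset fst P = image_mset fst Q"
  using assms
proof (induction "size z" arbitrary: z w rule: less_induct)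
  case less
  note z = less.prems(1) and w = less.prems(2) and eq = less.prems(3)
  show ?case
  proof (cases "z = {#}")
    case True
    then have "w = {#}" using eq val_eq_empty_iff[OF w] by simp
    then show ?thesis using True by (intro exI[of _ "{#}"]) simp
  next
    case False
    show ?thesis
    proof (cases "\<exists>u. u \<in># z \<and> u \<in># w")
      case True
      then obtain u z' w' where u: "z = add_mset u z'" "w = add_mset u w'" by (metis insert_DiffM)
      have "size z' < size z" "set_mset z' \<subseteq> generators" "set_mset w' \<subseteq> generators" "val z' = val w'"
        using z w eq u by auto
      then obtain r P Q where "z' = r + (\<Sum>b\<in>#P. block b)" "w' = r + (\<Sum>b\<in>#Q. block b)"
        "set_mset P \<subseteq> Sigma UNIV L" "set_mset Q \<subseteq> Sigma UNIV L" "image_mset fst P = image_mset fst Q"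
        using less.hyps by blast
      then show ?thesis unfolding u
        by (intro exI[of _ "add_mset u r"] exI[of _ P] exI[of _ Q]) simp
    next
      case disjoint: False
      from False obtain u where uz: "u \<in># z" by blast
      obtain k l j where u: "u = (k, l, j)" "l \<in> L k" "j < l" "u \<in> generators"
        using z uz by (auto simp: generators_def)
      have "u \<notin># w" using uz disjoint by blast
      then obtain l1 where l1: "l1 \<in> L k" "block (k, l1) \<subseteq># w"
        using block_subseteq_if_val_subseteq[of k l j z w] uz u w eq by auto
      have "(k, l1, 0) \<in># w" using l1 L_ge_2[OF l1(1)] by (auto simp: block_subseteq_iff)
      moreover from this have "(k, l1, 0) \<notin># z" using disjoint by blast
      ultimately obtain l2 where l2: "l2 \<in> L k" "block (k, l2) \<subseteq># z"
        using block_subseteq_if_val_subseteq[of k l1 0 w z] w z eq by auto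
      obtain z' w' where zw': "z = block (k, l2) + z'" "w = block (k, l1) + w'"
        using l1 l2 by (metis subset_mset.le_iff_add)
      have "block (k, l2) \<noteq> {#}" using size_block[of k l2] L_ge_2[OF l2(1)] by auto
      then have "size z' < size z" using zw' by (simp add: nonempty_has_size)
      moreover have "set_mset z' \<subseteq> generators" "set_mset w' \<subseteq> generators" "val z' = val w'"
        using z w eq val_block_eq[OF l1(1) l2(1)] unfolding zw' by auto
      ultimately obtain r P Q where "z' = r + (\<Sum>b\<in>#P. block b)" "w' = r + (\<Sum>b\<in>#Q. block b)"
        "set_mset P \<subseteq> Sigma UNIV L" "set_mset Q \<subseteq> Sigma UNIV L" "image_mset fst P = image_mset fst Q"
        using less.hyps by blast
      then show ?thesis unfolding zw' using l1 l2
        by (intro exI[of _ r] exI[of _ "add_mset (k, l2) P"] exI[of _ "add_mset (k, l1) Q"])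
          (simp add: ac_simps)
    qed
  qed
qed

lemma size_sum_blocks: "size (\<Sum>b\<in>#P. block b) = (\<Sum>b\<in>#P. snd b)"
proof (induction P)
  case (add b P)
  then show ?case
    using size_block[of "fst b" "snd b"] by (simp only: image_mset_add_mset sum_mset.add_mset size_union) simp
qed simp

text \<open>A single generator has no room for a block, as blocks have at least two members. So
  nothing is exchanged: \<open>P\<close> is empty, and \<open>Q\<close> with it.\<close>

lemma val_eq_generator_imp:
  assumes "u \<in> generators" "set_mset w \<subseteq> generators" "val w = val {#u#}"
  shows "w = {#u#}"
proof -
  obtain r P Q where rPQ: "{#u#} = r + (\<Sum>b\<in>#P. block b)" "w = r + (\<Sum>b\<in>#Q. block b)"
    "set_mset P \<subseteq> Sigma UNIV L" "image_mset fst P = image_mset fst Q"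
    using exchange[of "{#u#}" w] assms by auto
  have "P = {#}"
  proof (rule ccontr)
    assume "P \<noteq> {#}"
    then obtain b P' where P: "P = add_mset b P'" by (cases P) auto
    have "snd b \<ge> 2" using rPQ(3) L_ge_2 unfolding P by auto
    moreover have "size {#u#} = size r + (\<Sum>b\<in>#P. snd b)"
      unfolding rPQ(1) by (simp only: size_union size_sum_blocks)
    ultimately show False by (simp add: P)
  qed
  then show ?thesis using rPQ by simp
qed

section \<open>The monoid, its Krull property and its local tameness\<close>

lemma comm_monoid_cancel_monoid_of_blocks: "comm_monoid_cancel monoid_of_blocks"
proof (rule comm_monoid_cancelI)
  show "comm_monoid monoid_of_blocks"
  proof (rule comm_monoidI, unfold monoid_of_blocks_simps)
    show "x + y \<in> val ` {z. set_mset z \<subseteq> generators}"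
      if xy: "x \<in> val ` {z. set_mset z \<subseteq> generators}" "y \<in> val ` {z. set_mset z \<subseteq> generators}" for x y
    proof -
      obtain z where z: "set_mset z \<subseteq> generators" "x = val z" using xy(1) by blast
      obtain w where w: "set_mset w \<subseteq> generators" "y = val w" using xy(2) by blast
      have "x + y = val (z + w)" "set_mset (z + w) \<subseteq> generators" using z w by simp_all
      then show ?thesis by blast
    qed
    show "{#} \<in> val ` {z. set_mset z \<subseteq> generators}"
      by (rule image_eqI[of _ _ "{#}"]) simp_all
  qed (simp_all add: add.assoc add.commute)
qed (simp add: monoid_of_blocks_simps)

lemma Units_monoid_of_blocks: "Units monoid_of_blocks = {{#}}"
proof (intro equalityI subsetI)
  fix x assume "x \<in> Units monoid_of_blocks"
  then obtain y where "x + y = {#}"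
    unfolding Units_def monoid_of_blocks_simps by blast
  then show "x \<in> {{#}}" by simp
next
  interpret comm_monoid_cancel monoid_of_blocks by (rule comm_monoid_cancel_monoid_of_blocks)
  fix x :: "nat multiset" assume "x \<in> {{#}}"
  then show "x \<in> Units monoid_of_blocks"
    using Units_one_closed unfolding monoid_of_blocks_simps by simp
qed

sublocale presentation monoid_of_blocks generators val
proof (rule presentation.intro[OF comm_monoid_cancel_monoid_of_blocks presentation_axioms.intro])
  show "w = {#u#}" if "u \<in> generators" "set_mset w \<subseteq> generators" "val w = val {#u#}" for u w
    using that by (rule val_eq_generator_imp)
qed (simp_all only: monoid_of_blocks_simps Units_monoid_of_blocks val_empty val_union)

text \<open>The inclusion into the free monoid of all multisets is the required homomorphism: by
  \<open>val_subseteq_imp_factor\<close> the cofactor can be chosen inside the monoid.\<close>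

lemma krull_monoid_of_blocks: "krull_monoid monoid_of_blocks"
proof (rule krull_monoidI)
  show "(\<lambda>x. x) \<in> hom monoid_of_blocks (free_comm_monoid (UNIV :: nat set))"
    by (auto simp: hom_def free_comm_monoid_def monoid_of_blocks_def)
  fix a b
  assume "a \<in> carrier monoid_of_blocks" "b \<in> carrier monoid_of_blocks"
    and "a divides\<^bsub>free_comm_monoid (UNIV :: nat set)\<^esub> b"
  then obtain z w where zw: "set_mset z \<subseteq> generators" "set_mset w \<subseteq> generators" "a = val z" "b = val w"
    "val z \<subseteq># val w"
    unfolding monoid_of_blocks_simps by (auto simp: divides_free_comm_monoid)
  then obtain y where "set_mset y \<subseteq> generators" "val w = val z + val y"
    using val_subseteq_imp_factor by blast
  then show "a divides\<^bsub>monoid_of_blocks\<^esub> b"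
    using zw unfolding factor_def monoid_of_blocks_simps by blast
qed (rule comm_monoid_cancel_axioms)

text \<open>If \<open>u\<close> is missing in \<open>w\<close>, one exchange of blocks brings it in,
  and the sizes of the blocks involved are bounded in terms of the index \<open>k\<close> of
  \<open>u\<close> alone.\<close>

lemma locally_tame_monoid_of_blocks: "locally_tame monoid_of_blocks"
proof (rule locally_tameI)
  fix u assume "u \<in> generators"
  then obtain k l j where u: "u = (k, l, j)" "l \<in> L k" "j < l" by (auto simp: generators_def)
  show "\<exists>N. \<forall>z w. set_mset z \<subseteq> generators \<and> set_mset w \<subseteq> generators \<and> u \<in># z \<and> val z = val w
      \<longrightarrow> (\<exists>w'. set_mset w' \<subseteq> generators \<and> u \<in># w' \<and> val w' = val w \<and> factorization_dist w w' \<le> N)"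
  proof (rule exI[of _ "Max (L k)"], intro allI impI, elim conjE)
    fix z w
    assume z: "set_mset z \<subseteq> generators" and w: "set_mset w \<subseteq> generators"
      and uz: "u \<in># z" and eq: "val z = val w"
    show "\<exists>w'. set_mset w' \<subseteq> generators \<and> u \<in># w' \<and> val w' = val w \<and> factorization_dist w w' \<le> Max (L k)"
    proof (cases "u \<in># w")
      case True
      then show ?thesis using w by (intro exI[of _ w]) (simp add: factorization_dist_def)
    next
      case False
      then obtain l' where l': "l' \<in> L k" "block (k, l') \<subseteq># w"
        using block_subseteq_if_val_subseteq[of k l j z w] uz u z w eq by auto
      let ?v = "w - block (k, l')"
      let ?w' = "?v + block (k, l)"
      have wv: "w = ?v + block (k, l')" using l'(2) by simp
      \<comment> \<open>The common part contains \<open>?v\<close>, so the distance is at most the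
        larger of the two block sizes \<open>l'\<close> and \<open>l\<close>.\<close>
      have sub: "?v \<subseteq># w \<inter># ?w'" by simp
      have "size (w - w \<inter># ?w') \<le> size (w - ?v)" "size (?w' - w \<inter># ?w') \<le> size (?w' - ?v)"
        using sub by (auto intro!: size_mset_mono simp: subseteq_mset_def diff_le_mono2)
      moreover have "size (w - ?v) = l'" "size (?w' - ?v) = l"
        by (subst (1) wv; simp add: size_block) (simp add: size_block)
      moreover have "l \<le> Max (L k)" "l' \<le> Max (L k)" using u l' finite_L by auto
      ultimately have "factorization_dist w ?w' \<le> Max (L k)"
        by (simp add: factorization_dist_def Let_def)
      moreover have "val ?w' = val w" using l' u by (intro val_swap_block)
      moreover have "set_mset ?w' \<subseteq> generators" using w u by (intro set_swap_block)
      moreover have "u \<in># ?w'" using u by (auto simp: in_block_iff)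
      ultimately show ?thesis by blast
    qed
  qed
qed

section \<open>Unions of sets of lengths and distances in terms of blocks\<close>

lemma length_union_eq:
  "length_union monoid_of_blocks t =
     {size w |z w. set_mset z \<subseteq> generators \<and> set_mset w \<subseteq> generators \<and> val z = val w \<and> size z = t}"
  (is "_ = ?R")
proof (intro equalityI subsetI)
  fix n assume "n \<in> length_union monoid_of_blocks t"
  then obtain x where x: "set_mset x \<subseteq> generators" "t \<in> length_set monoid_of_blocks (val x)"
    "n \<in> length_set monoid_of_blocks (val x)"
    unfolding length_union_def length_system_def carrier_eq by blast
  then obtain z w where "set_mset z \<subseteq> generators" "val z = val x" "size z = t"
    "set_mset w \<subseteq> generators" "val w = val x" "size w = n"
    unfolding length_set_eq[OF x(1)] by blast
  then show "n \<in> ?R" by (intro CollectI exI[of _ z] exI[of _ w]) simp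
next
  fix n assume "n \<in> ?R"
  then obtain z w where zw: "set_mset z \<subseteq> generators" "set_mset w \<subseteq> generators" "val z = val w"
    "size z = t" "n = size w" by blast
  then have "t \<in> length_set monoid_of_blocks (val z)" "n \<in> length_set monoid_of_blocks (val z)"
    unfolding length_set_eq[OF zw(1)] by (metis (mono_tags, lifting) image_eqI mem_Collect_eq)+
  then show "n \<in> length_union monoid_of_blocks t"
    using \<phi>_closed[OF zw(1)] unfolding length_union_def length_system_def by blast
qed

text \<open>Let \<open>a < b\<close> be adjacent lengths of one element. Some block exchanged on the
  way from length \<open>a\<close> to length \<open>b\<close> is not of maximal size; replacing it
  alone by the next larger block of its index yields a length in \<open>{a + 1..a + d}\<close>, and
  adjacency forces \<open>b\<close> to be at most this length.\<close>

lemma distances_le: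
  assumes gap: "\<And>k l. l \<in> L k \<Longrightarrow> l < Max (L k) \<Longrightarrow> \<exists>l'\<in>L k. l < l' \<and> l' \<le> l + d"
  shows "distances monoid_of_blocks \<subseteq> {1..d}"
proof
  fix \<delta> assume "\<delta> \<in> distances monoid_of_blocks"
  then obtain z where z: "set_mset z \<subseteq> generators" "\<delta> \<in> distance_set (length_set monoid_of_blocks (val z))"
    unfolding distances_def length_system_def carrier_eq by auto
  define S where "S = length_set monoid_of_blocks (val z)"
  obtain a b where ab: "\<delta> > 0" "a \<in> S" "b \<in> S" "int b - int a = int \<delta>" "S \<inter> {a..b} = {a, b}"
    using z(2) unfolding distance_set_def S_def by auto
  obtain v w where v: "set_mset v \<subseteq> generators" "val v = val z" "size v = a"
    and w: "set_mset w \<subseteq> generators" "val w = val z" "size w = b"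
    using ab unfolding S_def length_set_eq[OF z(1)] by blast
  obtain r P Q where rPQ: "v = r + (\<Sum>b\<in>#P. block b)" "w = r + (\<Sum>b\<in>#Q. block b)"
    "set_mset P \<subseteq> Sigma UNIV L" "set_mset Q \<subseteq> Sigma UNIV L" "image_mset fst P = image_mset fst Q"
    using exchange[of v w] v w by auto
  have less: "(\<Sum>b\<in>#P. snd b) < (\<Sum>b\<in>#Q. snd b)"
  proof -
    have "a = size r + (\<Sum>b\<in>#P. snd b)" "b = size r + (\<Sum>b\<in>#Q. snd b)"
      using v(3) w(3) by (simp_all only: rPQ(1,2) size_union size_sum_blocks)
    moreover have "a < b" using ab(1,4) by simp
    ultimately show ?thesis by simp
  qed
  \<comment> \<open>Otherwise all blocks in \<open>P\<close> would be of maximal size, and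
    \<open>Q\<close>, having the same indices, could not have larger total size.\<close>
  have "\<exists>b\<in>#P. snd b < Max (L (fst b))"
  proof (rule ccontr)
    assume "\<not> ?thesis"
    then have "(\<Sum>b\<in>#P. Max (L (fst b))) \<le> (\<Sum>b\<in>#P. snd b)"
      by (intro sum_mset_mono) (auto simp: not_less)
    moreover have "(\<Sum>b\<in>#P. Max (L (fst b))) = (\<Sum>k\<in>#image_mset fst P. Max (L k))"
      by (simp add: multiset.map_comp comp_def)
    moreover have "\<dots> = (\<Sum>b\<in>#Q. Max (L (fst b)))"
      unfolding rPQ(5) by (simp add: multiset.map_comp comp_def)
    moreover have "(\<Sum>b\<in>#Q. snd b) \<le> (\<Sum>b\<in>#Q. Max (L (fst b)))"
      using rPQ(4) finite_L by (intro sum_mset_mono) auto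
    ultimately show False using less by simp
  qed
  then obtain k l where kl: "(k, l) \<in># P" "l < Max (L k)" by auto
  then have l: "l \<in> L k" using rPQ(3) by auto
  obtain l' where l': "l' \<in> L k" "l < l'" "l' \<le> l + d" using gap[OF l kl(2)] by blast
  have sub: "block (k, l) \<subseteq># v"
  proof -
    obtain P' where "P = add_mset (k, l) P'" using kl(1) by (metis insert_DiffM)
    then show ?thesis unfolding rPQ(1) by (simp add: subset_mset.add_increasing)
  qed
  let ?v' = "v - block (k, l) + block (k, l')"
  have "val ?v' = val z" using sub l l' v by (simp only: val_swap_block)
  moreover have "set_mset ?v' \<subseteq> generators" by (intro set_swap_block v l')
  ultimately have "size ?v' \<in> S" unfolding S_def length_set_eq[OF z(1)] by blast
  moreover have "size ?v' + l = a + l'"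
    using v(3) size_mset_mono[OF sub] by (simp add: size_Diff_submset[OF sub] size_block)
  ultimately have mem: "a + l' - l \<in> S" by (metis add_diff_cancel_right')
  have "b \<le> a + l' - l"
  proof (rule ccontr)
    assume neg: "\<not> ?thesis"
    then have "a + l' - l \<in> S \<inter> {a..b}" using mem l' by auto
    then show False using ab(5) neg l' by auto
  qed
  then show "\<delta> \<in> {1..d}" using ab l' by auto
qed

end

section \<open>Unions of sets of lengths\<close>

lemma distance_setI:
  assumes "a \<in> S" "b \<in> S" "a < b" "S \<inter> {a..b} = {a, b}"
  shows "b - a \<in> distance_set S"
  unfolding distance_set_def using assms by (intro CollectI conjI bexI[of _ a] bexI[of _ b]) auto

locale union_realization =
  fixes d :: nat and m :: "nat \<Rightarrow> nat" and U :: "nat \<Rightarrow> nat set"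
  assumes d_ge_2: "d \<ge> 2"
    and m_0: "m 0 = 0" and m_1: "m 1 = 1"
    and m_sum: "\<And>k. k \<ge> 3 \<Longrightarrow>
           (\<Sum>i=1..k-2. real k / real i * real (m i) + (real i - 1)) \<le> real (m (k - 1)) - (real k - 1)"
    and finite_U: "\<And>k. k \<ge> 1 \<Longrightarrow> finite (U k)"
    and U_1: "U 1 = {}"
    and U_nonempty: "\<And>k. k \<ge> 2 \<Longrightarrow> U k \<noteq> {}"
    and Min_U_gt: "\<And>k. k \<ge> 2 \<Longrightarrow> m (k - 1) + 1 < Min (U k)"
    and Min_U_le: "\<And>k. k \<ge> 2 \<Longrightarrow> Min (U k) \<le> m (k - 1) + d"
    and Max_U: "\<And>k. k \<ge> 2 \<Longrightarrow> Max (U k) = m k"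
    and U_distances: "\<And>k \<delta>. k \<ge> 2 \<Longrightarrow> \<delta> \<in> distance_set (U k) \<Longrightarrow> \<delta> \<le> d"
begin

lemma m_sum_term:
  assumes "k \<ge> 3" "1 \<le> i" "i \<le> k - 2"
  shows "real k / real i * real (m i) + (real i - 1) \<le> real (m (k - 1)) - (real k - 1)"
proof -
  have "real k / real i * real (m i) + (real i - 1)
      \<le> (\<Sum>i=1..k-2. real k / real i * real (m i) + (real i - 1))"
    using assms(2,3) by (intro member_le_sum) auto
  then show ?thesis using m_sum[OF assms(1)] by simp
qed

text \<open>The growth condition is applied at \<open>k + 1\<close>, keeping only the last summand
  \<open>i = k - 1\<close>, whose coefficient \<open>(k + 1) / (k - 1)\<close> is at least
  \<open>1\<close>.\<close>

lemma m_growth: "k \<ge> 2 \<Longrightarrow> m (k - 1) + k \<le> m k"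
proof -
  assume k: "k \<ge> 2"
  have "real (m (k - 1)) \<le> real (k + 1) / real (k - 1) * real (m (k - 1))"
    using k by (simp add: field_simps of_nat_diff)
  moreover have "real (k + 1) / real (k - 1) * real (m (k - 1)) + (real (k - 1) - 1)
      \<le> real (m (k + 1 - 1)) - (real (k + 1) - 1)"
    using k by (intro m_sum_term) auto
  moreover have "real (k - 1) \<ge> 1" "m (k + 1 - 1) = m k" using k by simp_all
  ultimately have "real (m (k - 1)) + k \<le> m k" by simp
  then show ?thesis by linarith
qed

lemma m_ge: "k \<le> m k"
proof -
  consider "k = 0" | "k = 1" | "k \<ge> 2" by linarith
  then show ?thesis using m_growth[of k] m_0 m_1 by cases auto
qed

text \<open>In the form \<open>m i / i \<le> m (t - 1) / t\<close>: trading a block of index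
  \<open>i \<le> t - 2\<close> lengthens it by a factor of at most
  \<open>m (t - 1) / t\<close>.\<close>

lemma mult_m_le:
  assumes "1 \<le> i" "i \<le> t - 2" "t \<ge> 3"
  shows "t * m i \<le> i * m (t - 1)"
proof -
  have "real t / real i * real (m i) \<le> real (m (t - 1))"
    using m_sum_term[OF assms(3,1,2)] assms by simp
  then have "real (t * m i) \<le> real (i * m (t - 1))"
    using assms by (simp add: field_simps)
  then show ?thesis by linarith
qed

section \<open>The sets \<open>U k\<close> and the block lengths\<close>

lemma U_bounds:
  assumes "k \<ge> 2" "x \<in> U k"
  shows "m (k - 1) + 1 < x" "x \<le> m k"
proof -
  have "finite (U k)" using finite_U assms by simp
  then have "Min (U k) \<le> x" "x \<le> Max (U k)" using assms by simp_all
  then show "m (k - 1) + 1 < x" "x \<le> m k"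
    using Min_U_gt[OF assms(1)] Max_U[OF assms(1)] by linarith+
qed

lemma U_extrema_in:
  assumes "k \<ge> 2"
  shows "Min (U k) \<in> U k" "m k \<in> U k"
proof -
  have fin: "finite (U k)" using finite_U assms by simp
  show "Min (U k) \<in> U k" using fin U_nonempty[OF assms] by (rule Min_in)
  have "Max (U k) \<in> U k" using fin U_nonempty[OF assms] by (rule Max_in)
  then show "m k \<in> U k" using Max_U[OF assms] by simp
qed

lemma U_successor:
  assumes "k \<ge> 2" "a \<in> U k" "a < m k"
  obtains b where "b \<in> U k" "a < b" "b \<le> a + d" "U k \<inter> {a..b} = {a, b}"
proof -
  let ?S = "{x \<in> U k. a < x}"
  define b where "b = Min ?S"
  have fin: "finite ?S" using finite_U assms by simp
  moreover have "?S \<noteq> {}" using U_extrema_in assms by blast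
  ultimately have "b \<in> ?S" unfolding b_def by (rule Min_in)
  then have b: "b \<in> U k" "a < b" by simp_all
  have "b \<le> x" if "x \<in> U k" "a < x" for x using fin that unfolding b_def by simp
  then have cap: "U k \<inter> {a..b} = {a, b}" using assms(2) b by force
  have "b - a \<in> distance_set (U k)" using assms(2) b cap by (rule distance_setI)
  then have "b - a \<le> d" using U_distances[OF assms(1)] by blast
  then show ?thesis using that b cap by simp
qed

text \<open>There are no blocks with index below \<open>2\<close>: at \<open>k = 1\<close> the
  formula would give \<open>{1}\<close>, a block with a single member.\<close>

definition lengths :: "nat \<Rightarrow> nat set" where
  "lengths k = (if k \<ge> 2 then {k..m (k - 1) + 1} \<union> U k else {})"

lemma lengths_bounds:
  assumes "l \<in> lengths k"
  shows "k \<ge> 2" "k \<le> l" "l \<le> m k"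
proof -
  show k: "k \<ge> 2" using assms by (auto simp: lengths_def split: if_splits)
  have "m (k - 1) + 1 < l \<and> l \<le> m k" if "l \<in> U k" using U_bounds[OF k that] by simp
  moreover have "k \<le> l \<and> l \<le> m (k - 1) + 1 \<or> l \<in> U k" using assms k by (auto simp: lengths_def)
  ultimately show "k \<le> l" "l \<le> m k"
    using k m_ge[of "k - 1"] m_growth[OF k] by linarith+
qed

sublocale block_monoid lengths
proof
  show "finite (lengths k)" for k using finite_U by (auto simp: lengths_def)
  show "2 \<le> l" if "l \<in> lengths k" for l k using lengths_bounds[OF that] by simp
qed

lemma k_in_lengths: "k \<ge> 2 \<Longrightarrow> k \<in> lengths k"
  using m_ge[of "k - 1"] by (auto simp: lengths_def)

lemma Max_lengths: "k \<ge> 2 \<Longrightarrow> Max (lengths k) = m k"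
  by (rule Max_eqI[OF finite_L lengths_bounds(3)]) (simp_all add: lengths_def U_extrema_in)

text \<open>Inside \<open>U k\<close> the gaps are bounded by assumption, and inside the interval
  they are \<open>1\<close>. The jump from the end \<open>m (k - 1) + 1\<close> of the interval to
  \<open>Min (U k)\<close> is at most \<open>d - 1\<close>.\<close>

lemma lengths_gap:
  assumes l: "l \<in> lengths k" "l < Max (lengths k)"
  shows "\<exists>l'\<in>lengths k. l < l' \<and> l' \<le> l + d"
proof -
  have k: "k \<ge> 2" using l lengths_bounds by blast
  then have less: "l < m k" using l Max_lengths by simp
  consider "l \<in> U k" | "k \<le> l" "l \<le> m (k - 1)" | "l = m (k - 1) + 1"
    using l(1) k unfolding lengths_def by (cases "l \<le> m (k - 1)") auto
  then show ?thesis
  proof cases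
    case 1
    then obtain b where "b \<in> U k" "l < b" "b \<le> l + d" using U_successor[OF k _ less] by blast
    then show ?thesis using k by (auto simp: lengths_def)
  next
    case 2
    then have "l + 1 \<in> lengths k" using k by (simp add: lengths_def)
    then show ?thesis using d_ge_2 by (intro bexI[of _ "l + 1"]) auto
  next
    case 3
    then show ?thesis using U_extrema_in[OF k] Min_U_le[OF k] Min_U_gt[OF k] k
      by (intro bexI[of _ "Min (U k)"]) (auto simp: lengths_def)
  qed
qed

section \<open>Lengths reachable from a factorization of length \<open>t\<close>\<close>

lemma size_bound:
  assumes z: "set_mset z \<subseteq> generators" and w: "set_mset w \<subseteq> generators"
    and eq: "val z = val w" and t: "size z = t" "t \<ge> 1" and wt: "size w \<ge> t"
  shows "size w \<in> {t..m (t - 1) + 1} \<union> U t"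
proof -
  obtain r P Q where rPQ: "z = r + (\<Sum>b\<in>#P. block b)" "w = r + (\<Sum>b\<in>#Q. block b)"
    "set_mset P \<subseteq> Sigma UNIV lengths" "set_mset Q \<subseteq> Sigma UNIV lengths"
    "image_mset fst P = image_mset fst Q"
    using exchange[OF z w eq] by blast
  \<comment> \<open>\<open>N\<close> collects the indices of the exchanged blocks, which agree on
    both sides. A block of index \<open>k\<close> has at least \<open>k\<close> members, which is
    used for \<open>z\<close>, and at most \<open>m k\<close>, which is used for
    \<open>w\<close>.\<close>
  define N where "N = image_mset fst P"
  have NQ: "N = image_mset fst Q" by (simp add: N_def rPQ(5))
  have t_eq: "t = size r + (\<Sum>b\<in>#P. snd b)"
    using t(1) by (simp only: rPQ(1) size_union size_sum_blocks)
  have w_eq: "size w = size r + (\<Sum>b\<in>#Q. snd b)"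
    by (simp only: rPQ(2) size_union size_sum_blocks)
  have P_bounds: "2 \<le> fst b" "fst b \<le> snd b" if "b \<in># P" for b
  proof -
    have "snd b \<in> lengths (fst b)" using that rPQ(3) by (cases b) auto
    then show "2 \<le> fst b" "fst b \<le> snd b" by (rule lengths_bounds)+
  qed
  have Q_bounds: "snd b \<le> m (fst b)" if "b \<in># Q" for b
  proof -
    have "snd b \<in> lengths (fst b)" using that rPQ(4) by (cases b) auto
    then show ?thesis by (rule lengths_bounds)
  qed
  have "(\<Sum>k\<in>#N. k) \<le> (\<Sum>b\<in>#P. snd b)"
    unfolding N_def using P_bounds(2) by (simp add: sum_mset_mono)
  then have lower: "size r + (\<Sum>k\<in>#N. k) \<le> t" using t_eq by linarith
  have "(\<Sum>b\<in>#Q. snd b) \<le> (\<Sum>b\<in>#Q. m (fst b))"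
    using Q_bounds by (rule sum_mset_mono)
  also have "\<dots> = (\<Sum>k\<in>#N. m k)" unfolding NQ by (simp add: multiset.map_comp comp_def)
  finally have upper: "size w \<le> size r + (\<Sum>k\<in>#N. m k)" using w_eq by linarith
  have N_ge_2: "k \<ge> 2" if "k \<in># N" for k
    using that P_bounds(1) unfolding N_def by auto
  have "k \<le> t - 2" if "k \<in># N" "k < t" "t - 1 \<notin># N" for k
    using that by (cases "k = t - 1") auto
  then have "(\<exists>k\<in>#N. k \<ge> t) \<or> t - 1 \<in># N \<or> (\<forall>k\<in>#N. k \<le> t - 2)"
    by (metis not_le)
  then consider (empty) "N = {#}" | (top) k where "k \<in># N" "k \<ge> t"
    | (second) "t - 1 \<in># N" | (rest) "N \<noteq> {#}" "\<forall>k\<in>#N. k \<le> t - 2"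
    by blast
  then show ?thesis
  proof cases
    case empty
    then have "P = {#}" "Q = {#}" using N_def NQ by auto
    then have "size w = t" using t_eq w_eq by simp
    then show ?thesis using m_ge[of "t - 1"] by auto
  next
    case top
    \<comment> \<open>A block of index \<open>k \<ge> t\<close> already fills \<open>z\<close>, so
      \<open>k = t\<close> and nothing else is left; then \<open>w\<close> is a single block of
      index \<open>t\<close>.\<close>
    then obtain l where "(k, l) \<in># P" by (auto simp: N_def)
    then obtain P' where P': "P = add_mset (k, l) P'" by (metis insert_DiffM)
    then have l: "k \<le> l" "k \<ge> 2" using P_bounds[of "(k, l)"] by simp_all
    have "t = size r + l + (\<Sum>b\<in>#P'. snd b)" using t_eq unfolding P' by simp
    then have sums: "k = t" "size r = 0" "(\<Sum>b\<in>#P'. snd b) = 0" using top l by linarith+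
    have "P' = {#}"
    proof (rule ccontr)
      assume "P' \<noteq> {#}"
      then obtain b P'' where P'': "P' = add_mset b P''" by (cases P') auto
      then have "b \<in># P" unfolding P' by simp
      then have "snd b \<ge> 2" using P_bounds[of b] by linarith
      then show False using sums P'' by simp
    qed
    then have "image_mset fst Q = {#t#}" using rPQ(5) P' sums by simp
    moreover from this have "size Q = 1" by (metis size_image_mset size_single)
    then obtain b where "Q = {#b#}" using size_1_singleton_mset by blast
    ultimately have "size w = snd b" "snd b \<in> lengths t" using w_eq sums(2) rPQ(4) by auto
    then show ?thesis using l sums by (auto simp: lengths_def)
  next
    case second
    then obtain N' where N': "N = add_mset (t - 1) N'" by (metis insert_DiffM)
    \<comment> \<open>After an index \<open>t - 1\<close> only one unit of length remains. A further
      index would need at least two, so at most one generator is left, which accounts for the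
      \<open>+ 1\<close> at the end of the interval.\<close>
    have small: "size r + (\<Sum>k\<in>#N'. k) \<le> 1" using lower t(2) unfolding N' by simp
    have "N' = {#}"
    proof (rule ccontr)
      assume "N' \<noteq> {#}"
      then obtain k N'' where N'': "N' = add_mset k N''" by (cases N') auto
      then have "k \<ge> 2" using N_ge_2 N' by simp
      then show False using small N'' by simp
    qed
    then have "size w \<le> m (t - 1) + 1" using upper N' small by simp
    then show ?thesis using wt by simp
  next
    case rest
    then obtain k where "k \<in># N" by blast
    then have "2 \<le> t - 2" using rest(2) N_ge_2 le_trans by blast
    then have t4: "t \<ge> 4" by simp
    \<comment> \<open>The generators in \<open>r\<close> are treated like blocks of index
      \<open>1\<close>, as \<open>m 1 = 1\<close>, so that the same ratio bounds all parts of
      \<open>w\<close>.\<close>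
    have "t \<le> m (t - 1)" using mult_m_le[of 1 t] m_1 t4 by simp
    then have "t * size r \<le> m (t - 1) * size r" by (rule mult_le_mono1)
    moreover have "t * (\<Sum>k\<in>#N. m k) \<le> m (t - 1) * (\<Sum>k\<in>#N. k)"
    proof -
      have "t * m k \<le> m (t - 1) * k" if "k \<in># N" for k
        using mult_m_le[of k t] N_ge_2[OF that] rest that t4 by (simp add: mult.commute)
      then have "(\<Sum>k\<in>#N. t * m k) \<le> (\<Sum>k\<in>#N. m (t - 1) * k)" by (rule sum_mset_mono)
      then show ?thesis by (simp only: sum_mset_distrib_left)
    qed
    ultimately have "t * (size r + (\<Sum>k\<in>#N. m k)) \<le> m (t - 1) * (size r + (\<Sum>k\<in>#N. k))"
      unfolding distrib_left by (rule add_mono)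
    also have "\<dots> \<le> m (t - 1) * t" using lower by (rule mult_le_mono2)
    finally have "size r + (\<Sum>k\<in>#N. m k) \<le> m (t - 1)" using t4 by simp
    then show ?thesis using upper wt by auto
  qed
qed

lemma length_union_monoid_of_blocks:
  assumes "t \<ge> 1"
  shows "length_union monoid_of_blocks t \<inter> {t..} = {t..m (t - 1) + 1} \<union> U t"
proof (intro equalityI subsetI)
  fix n assume "n \<in> length_union monoid_of_blocks t \<inter> {t..}"
  then obtain z w where "set_mset z \<subseteq> generators" "set_mset w \<subseteq> generators" "val z = val w"
    "size z = t" "n = size w" "t \<le> n"
    unfolding length_union_eq by blast
  then show "n \<in> {t..m (t - 1) + 1} \<union> U t" using size_bound assms by simp
next
  fix n assume n: "n \<in> {t..m (t - 1) + 1} \<union> U t"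
  show "n \<in> length_union monoid_of_blocks t \<inter> {t..}"
  proof (cases "t = 1")
    case True
    then have "n = 1" using n m_0 U_1 by simp
    \<comment> \<open>Any atom witnesses that \<open>1\<close> is a length.\<close>
    have "(2, 2, 0) \<in> generators" using k_in_lengths[of 2] by (simp add: generators_def)
    then have "\<exists>z w. n = size w \<and> set_mset z \<subseteq> generators \<and> set_mset w \<subseteq> generators \<and>
        val z = val w \<and> size z = t"
      using True \<open>n = 1\<close>
      by (intro exI[of _ "{#(2, 2, 0)#}"]) simp
    then show ?thesis unfolding length_union_eq using True \<open>n = 1\<close> by simp
  next
    case False
    then have "t \<ge> 2" using assms by simp
    then have t: "t \<in> lengths t" "n \<in> lengths t" using n k_in_lengths by (simp_all add: lengths_def)
    then have "n \<ge> t" by (intro lengths_bounds(2))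
    moreover have "\<exists>z w. n = size w \<and> set_mset z \<subseteq> generators \<and> set_mset w \<subseteq> generators \<and>
        val z = val w \<and> size z = t"
      \<comment> \<open>The blocks of sizes \<open>t\<close> and \<open>n\<close> with index
        \<open>t\<close> have the same product.\<close>
      by (rule exI[of _ "block (t, t)"], rule exI[of _ "block (t, n)"])
        (use set_block_subseteq[OF t(1)] set_block_subseteq[OF t(2)] val_block_eq[OF t] in
          \<open>simp add: size_block\<close>)
    ultimately show ?thesis unfolding length_union_eq by simp
  qed
qed

text \<open>For large \<open>k\<close> the central part contains the consecutive numbers
  \<open>m (k - 1)\<close> and \<open>m (k - 1) + 1\<close>, which forces difference
  \<open>1\<close>. It also contains the two smallest elements of \<open>U k\<close>; they are
  adjacent in it but, by \<open>gap\<close>, not consecutive.\<close>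

lemma not_eventually_AAP:
  assumes gap: "\<forall>k\<ge>2. Min (U k) + 1 \<notin> U k"
  shows "\<not> (\<forall>\<^sub>F k in sequentially. is_AAP d' M (length_union monoid_of_blocks k))"
proof
  assume "\<forall>\<^sub>F k in sequentially. is_AAP d' M (length_union monoid_of_blocks k)"
  then obtain K where K: "\<And>k. k \<ge> K \<Longrightarrow> is_AAP d' M (length_union monoid_of_blocks k)"
    unfolding eventually_sequentially by blast
  \<comment> \<open>This size ensures \<open>k + M \<le> m (k - 1)\<close> and
    \<open>m (k - 1) + 2 * d + M \<le> m k\<close>, so that truncation by \<open>M\<close> at both
    ends keeps everything from \<open>m (k - 1)\<close> to \<open>m (k - 1) + 2 * d\<close> that
    lies in \<open>V\<close>.\<close>
  define k where "k = K + M + 2 * d + 3"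
  have k: "k \<ge> 2" "k \<ge> 1" "k \<ge> K" "k \<ge> M + 2 * d + 3" by (simp_all add: k_def)
  define V where "V = length_union monoid_of_blocks k"
  define R where "R = {x \<in> V. Inf (enat ` V) + enat M \<le> enat x \<and> enat x + enat M \<le> Sup (enat ` V)}"
  have V: "V \<inter> {k..} = {k..m (k - 1) + 1} \<union> U k"
    unfolding V_def using k(2) by (rule length_union_monoid_of_blocks)
  have R_dist: "distance_set R \<subseteq> {d'}"
    using K[OF k(3)] unfolding is_AAP_def is_AP_def R_def V_def by blast
  have in_V: "x \<in> V" if "k \<le> x" "x \<le> m (k - 1) + 1 \<or> x \<in> U k" for x
  proof -
    have "x \<in> {k..m (k - 1) + 1} \<union> U k" using that by auto
    then show ?thesis unfolding V[symmetric] by simp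
  qed
  have "k \<le> m (k - 1) + 1" using m_ge[of "k - 1"] by linarith
  then have "k \<in> V" "m k \<in> V"
    using in_V[of k] in_V[of "m k"] m_ge[of k] U_extrema_in(2)[OF k(1)] by simp_all
  then have Inf_Sup: "Inf (enat ` V) \<le> enat k" "enat (m k) \<le> Sup (enat ` V)"
    by (simp_all add: Inf_lower Sup_upper)
  \<comment> \<open>Only \<open>Inf V \<le> k\<close> and \<open>m k \<le> Sup V\<close> enter, so
    the lengths below \<open>k\<close> need not be known.\<close>
  have in_R: "x \<in> R" if "x \<in> V" "k + M \<le> x" "x + M \<le> m k" for x
  proof -
    have "Inf (enat ` V) + enat M \<le> enat k + enat M" using Inf_Sup(1) by (rule add_right_mono)
    also have "\<dots> \<le> enat x" using that by simp
    finally have "Inf (enat ` V) + enat M \<le> enat x" .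
    moreover have "enat x + enat M \<le> enat (m k)" using that by simp
    then have "enat x + enat M \<le> Sup (enat ` V)" using Inf_Sup(2) by (rule order_trans)
    ultimately show ?thesis using that(1) by (simp add: R_def)
  qed
  have low: "k + M \<le> m (k - 1)"
  proof -
    have "k - 1 - 1 = k - 2" "2 \<le> k - 1" using k(4) by linarith+
    then have "m (k - 2) + (k - 1) \<le> m (k - 1)" using m_growth[of "k - 1"] by metis
    then show ?thesis using m_ge[of "k - 2"] k(4) by linarith
  qed
  have high: "m (k - 1) + 2 * d + M \<le> m k" using m_growth[OF k(1)] k by simp
  define c where "c = m (k - 1)"
  have "c \<in> R" "c + 1 \<in> R"
    using low high d_ge_2 by (intro in_R in_V; simp add: c_def)+
  moreover have "{c..c + 1} = {c, c + 1}" by auto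
  then have "R \<inter> {c..c + 1} = {c, c + 1}" using calculation by simp
  ultimately have "(c + 1) - c \<in> distance_set R" by (intro distance_setI) simp_all
  then have d': "d' = 1" using R_dist by auto
  define a where "a = Min (U k)"
  have a: "a \<in> U k" "m (k - 1) + 1 < a" "a \<le> m (k - 1) + d"
    unfolding a_def using U_extrema_in Min_U_gt Min_U_le k(1) by simp_all
  then have "a < m k" using high k d_ge_2 by simp
  \<comment> \<open>\<open>b\<close> is the second smallest element of \<open>U k\<close>, and
    \<open>b \<le> m (k - 1) + 2 * d\<close> keeps it in the central part.\<close>
  then obtain b where b: "b \<in> U k" "a < b" "b \<le> a + d" "U k \<inter> {a..b} = {a, b}"
    using U_successor[OF k(1) a(1)] by blast
  have ab: "a \<in> R" "b \<in> R"
    using in_R[of a] in_R[of b] in_V[of a] in_V[of b] a b(1-3) low high by linarith+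
  have "R \<inter> {a..b} \<subseteq> U k \<inter> {a..b}"
  proof
    fix x assume x: "x \<in> R \<inter> {a..b}"
    then have "x \<in> V" "k \<le> x" using a low by (simp_all add: R_def)
    then have "x \<in> {k..m (k - 1) + 1} \<union> U k" unfolding V[symmetric] by simp
    then show "x \<in> U k \<inter> {a..b}" using x a(2) by auto
  qed
  then have "R \<inter> {a..b} = {a, b}" using ab b(2,4) by auto
  then have "b - a \<in> distance_set R" using ab b(2) by (intro distance_setI)
  then have "b - a = 1" using R_dist d' by blast
  then have "b = a + 1" using b(2) by simp
  then show False using gap k(1) b(1) by (simp add: a_def)
qed

lemma interval_disjoint_U:
  assumes "k \<ge> 1"
  shows "{k..m (k - 1) + 1} \<inter> U k = {}"
proof (cases "k = 1")
  case False
  then have "m (k - 1) + 1 < x" if "x \<in> U k" for x using U_bounds(1)[of k x] assms that by simp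
  then show ?thesis by fastforce
qed (use U_1 in simp)

end

theorem theorem4p2:
  fixes d :: nat and m :: "nat \<Rightarrow> nat" and U :: "nat \<Rightarrow> nat set"
  assumes "d \<ge> 2"
    and "m 0 = 0" and "m 1 = 1"
    and "\<And>k. k \<ge> 3 \<Longrightarrow>
           (\<Sum>i=1..k-2. real k / real i * real (m i) + (real i - 1)) \<le> real (m (k - 1)) - (real k - 1)"
    and "\<And>k. k \<ge> 1 \<Longrightarrow> finite (U k)"
    and "\<And>k x. k \<ge> 1 \<Longrightarrow> x \<in> U k \<Longrightarrow> x > 0"
    and "U 1 = {}"
    and "\<And>k. k \<ge> 2 \<Longrightarrow> U k \<noteq> {}"
    and "\<And>k. k \<ge> 2 \<Longrightarrow> m (k - 1) + 1 < Min (U k)"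
    and "\<And>k. k \<ge> 2 \<Longrightarrow> Min (U k) \<le> m (k - 1) + d"
    and "\<And>k. k \<ge> 2 \<Longrightarrow> Max (U k) = m k"
    and "\<And>k \<delta>. k \<ge> 2 \<Longrightarrow> \<delta> \<in> distance_set (U k) \<Longrightarrow> \<delta> \<le> d"
  shows "\<exists>H :: nat multiset monoid.
           krull_monoid H \<and> locally_tame H \<and>
           finite (distances H) \<and> distances H \<subseteq> {1..d} \<and>
           (\<forall>k\<ge>1. length_union H k \<inter> {k..} = {k..m (k - 1) + 1} \<union> U k \<and>
                   {k..m (k - 1) + 1} \<inter> U k = {}) \<and>
           ((\<forall>k\<ge>2. Min (U k) + 1 \<notin> U k) \<longrightarrow>
              \<not> (\<exists>M>0. \<forall>\<^sub>F k in sequentially. is_AAP 1 M (length_union H k)) \<and>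
              \<not> structure_theorem_for_unions H)"
proof -
  interpret union_realization d m U
    by (rule union_realization.intro; fact assms)
  have distances: "distances monoid_of_blocks \<subseteq> {1..d}"
    using lengths_gap by (rule distances_le)
  then have finite: "finite (distances monoid_of_blocks)" by (rule finite_subset) simp
  show ?thesis
  proof (intro exI[of _ monoid_of_blocks] conjI allI impI)
    fix k :: nat assume k: "1 \<le> k"
    show "length_union monoid_of_blocks k \<inter> {k..} = {k..m (k - 1) + 1} \<union> U k"
      by (rule length_union_monoid_of_blocks[OF k])
    show "{k..m (k - 1) + 1} \<inter> U k = {}" by (rule interval_disjoint_U[OF k])
  next
    assume gap: "\<forall>k\<ge>2. Min (U k) + 1 \<notin> U k"
    show "\<not> (\<exists>M>0. \<forall>\<^sub>F k in sequentially. is_AAP 1 M (length_union monoid_of_blocks k))"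
      using not_eventually_AAP[OF gap] by blast
    show "\<not> structure_theorem_for_unions monoid_of_blocks"
      using not_eventually_AAP[OF gap] unfolding structure_theorem_for_unions_def by blast
  qed (rule krull_monoid_of_blocks locally_tame_monoid_of_blocks finite distances)+
qed

end
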